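(* Let $s\ge 1$ be an integer or half-integer, and let $R=\sum_{j=0}^{2s} r_j P^j$ (with $r_j\in\mathbb{C}$) be an $sl_2$-invariant operator on $V_s\otimes V_s$ which satisfies the constant Yang--Baxter equation $$R_{12}R_{23}R_{12}=R_{23}R_{12}R_{23}\quad\text{on } V_s^{\otimes 3}$$ and $r_{2s}=1$. Then either $r_{2s-1}=1$ or $r_{2s-1}=-1$. Moreover: I. If $r_{2s-1}=1$ and $R\neq\mathbb{E}$, then there are an integer $m$ with $2\le m\le 2s$, a constant $g\in\mathbb{C}$ and constants $\tilde r_j\in\mathbb{C}$ ($0\le j\le 2s-m-1$) such that $$R=\mathbb{E}+g\,P^{2s-m}+\sum_{j=0}^{2s-m-1}\tilde r_j\,P^j ,$$ where $g$ satisfies $$1+g+\eta_{m,m}^2\,g^2=0,\qquad \eta_{m,m}=\frac{(2s)!}{(2s-m)!}\,\frac{(4s-2m+1)!}{(4s-m+1)!},$$ and, if $m<2s$, then $\tilde r_{2s-m-1}\neq 0$. II. If $r_{2s-1}=-1$, then $R=\mathbb{P}$.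
   Context: $V_s$ is the irreducible representation of $sl_2$ (over $\mathbb{C}$) of spin $s$, of dimension $2s+1$. $P^j$ ($j=0,1,\dots,2s$) is the $sl_2$-invariant projector of $V_s\otimes V_s$ onto its irreducible component of spin $j$. $\mathbb{E}$ is the identity operator and $\mathbb{P}$ the permutation (flip) operator on $V_s\otimes V_s$. For an operator $X$ on $V_s\otimes V_s$, $X_{12}$ and $X_{23}$ denote the operators on $V_s^{\otimes 3}$ acting as $X$ on the tensor factors $1,2$ (resp. $2,3$) and as the identity on the remaining one. An empty sum is zero. *)

theory Defs
  imports Complex_Main "Jordan_Normal_Form.Matrix"
begin

text \<open>
  Spins are encoded by the natural number \<open>n = 2s\<close>. The irreducible \<open>sl\<^sub>2\<close>-representation
  \<open>V\<^sub>s\<close> is \<open>\<complex>\<^bsup>n+1\<^esup>\<close> with a weight basis \<open>v\<^sub>0, \<dots>, v\<^sub>n\<close> and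
  \<open>E v\<^sub>k = (n-k+1) v\<^bsub>k-1\<^esub>\<close>, \<open>F v\<^sub>k = (k+1) v\<^bsub>k+1\<^esub>\<close>, \<open>H v\<^sub>k = (n-2k) v\<^sub>k\<close>.
  That this is a representation of \<open>sl\<^sub>2\<close>, and an irreducible one, is proved below.
\<close>

datatype sl2_gen = E_gen | F_gen | H_gen

fun spin_rep :: "nat \<Rightarrow> sl2_gen \<Rightarrow> complex mat" where
  "spin_rep n E_gen = mat (n+1) (n+1) (\<lambda>(i,k). if k = i + 1 then of_nat (n - i) else 0)"
| "spin_rep n F_gen = mat (n+1) (n+1) (\<lambda>(i,k). if i = k + 1 then of_nat i else 0)"
| "spin_rep n H_gen = mat (n+1) (n+1) (\<lambda>(i,k). if i = k then of_nat n - 2 * of_nat i else 0)"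

text \<open>
  Kronecker product: the basis vector \<open>v\<^sub>i \<otimes> v\<^sub>j\<close> has index \<open>i * d + j\<close>, where \<open>d\<close> is the
  dimension of the second factor. This indexing is strictly associative.
\<close>

definition tensor_mat :: "complex mat \<Rightarrow> complex mat \<Rightarrow> complex mat" where
  "tensor_mat A B = mat (dim_row A * dim_row B) (dim_col A * dim_col B)
     (\<lambda>(i,j). A $$ (i div dim_row B, j div dim_col B) * B $$ (i mod dim_row B, j mod dim_col B))"

definition tensor_rep :: "nat \<Rightarrow> sl2_gen \<Rightarrow> complex mat" where
  "tensor_rep n x = tensor_mat (spin_rep n x) (1\<^sub>m (n+1)) + tensor_mat (1\<^sub>m (n+1)) (spin_rep n x)"

definition op12 :: "nat \<Rightarrow> complex mat \<Rightarrow> complex mat" where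
  "op12 n X = tensor_mat X (1\<^sub>m (n+1))"

definition op23 :: "nat \<Rightarrow> complex mat \<Rightarrow> complex mat" where
  "op23 n X = tensor_mat (1\<^sub>m (n+1)) X"

definition flip_mat :: "nat \<Rightarrow> complex mat" where
  "flip_mat n = mat ((n+1)^2) ((n+1)^2)
     (\<lambda>(i,j). if i div (n+1) = j mod (n+1) \<and> i mod (n+1) = j div (n+1) then 1 else 0)"

text \<open>
  \<open>P\<close> is the invariant projector of \<open>V\<^sub>s \<otimes> V\<^sub>s\<close> onto its irreducible component of spin \<open>j\<close>
  (\<open>n = 2s\<close>): an idempotent commuting with \<open>sl\<^sub>2\<close> whose range is the image of an injective
  intertwiner \<open>T\<close> from the spin \<open>j\<close> representation. Here \<open>j\<close> is the spin itself, not its double.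
\<close>

definition spin_projector :: "nat \<Rightarrow> nat \<Rightarrow> complex mat \<Rightarrow> bool" where
  "spin_projector n j P \<longleftrightarrow>
     P \<in> carrier_mat ((n+1)^2) ((n+1)^2) \<and> P * P = P \<and>
     (\<forall>x. P * tensor_rep n x = tensor_rep n x * P) \<and>
     (\<exists>T \<in> carrier_mat ((n+1)^2) (2*j+1).
        (\<forall>x. tensor_rep n x * T = T * spin_rep (2*j) x) \<and>
        inj_on (\<lambda>v. T *\<^sub>v v) (carrier_vec (2*j+1)) \<and>
        (\<lambda>v. P *\<^sub>v v) ` carrier_vec ((n+1)^2) = (\<lambda>v. T *\<^sub>v v) ` carrier_vec (2*j+1))"

text \<open>The linear combination \<open>\<Sum>j\<in>J. r j P\<^sup>j\<close>; it is the zero matrix for empty \<open>J\<close>.\<close>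

definition lincomb_mat ::
    "nat \<Rightarrow> nat set \<Rightarrow> (nat \<Rightarrow> complex) \<Rightarrow> (nat \<Rightarrow> complex mat) \<Rightarrow> complex mat" where
  "lincomb_mat n J r P = mat ((n+1)^2) ((n+1)^2) (\<lambda>(a,b). \<Sum>j\<in>J. r j * P j $$ (a,b))"

text \<open>\<open>\<eta>\<^sub>m\<^sub>m\<close> for \<open>n = 2s\<close>; meaningful for \<open>m \<le> n\<close> (the subtractions are truncated).\<close>

definition eta :: "nat \<Rightarrow> nat \<Rightarrow> complex" where
  "eta n m = (fact n / fact (n - m)) * (fact (2*n - 2*m + 1) / fact (2*n - m + 1))"


lemma spin_rep_carrier [simp]: "spin_rep n x \<in> carrier_mat (n+1) (n+1)"
  by (cases x) auto

lemma dim_spin_rep: "dim_row (spin_rep n x) = n+1" "dim_col (spin_rep n x) = n+1"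
  using spin_rep_carrier[of n x] by blast+

lemma spin_rep_apply:
  assumes "w \<in> carrier_vec (n+1)" "i \<le> n"
  shows "(spin_rep n x *\<^sub>v w) $ i = (\<Sum>k = 0..<Suc n. spin_rep n x $$ (i,k) * w $ k)"
  using assms dim_spin_rep[of n x]
  by (simp add: scalar_prod_def del: spin_rep.simps sum.op_ivl_Suc)

lemma spin_rep_E_apply:
  assumes "w \<in> carrier_vec (n+1)" "i \<le> n"
  shows "(spin_rep n E_gen *\<^sub>v w) $ i = (if i < n then of_nat (n - i) * w $ (i + 1) else 0)"
proof -
  have "(spin_rep n E_gen *\<^sub>v w) $ i =
      (\<Sum>k = 0..<Suc n. if k = i + 1 then of_nat (n - i) * w $ k else 0)"
    unfolding spin_rep_apply[OF assms] by (rule sum.cong) (use assms in auto)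
  also have "\<dots> = (if i < n then of_nat (n - i) * w $ (i + 1) else 0)"
    by (subst sum.delta) auto
  finally show ?thesis .
qed

lemma spin_rep_F_apply:
  assumes "w \<in> carrier_vec (n+1)" "i \<le> n"
  shows "(spin_rep n F_gen *\<^sub>v w) $ i = (if i > 0 then of_nat i * w $ (i - 1) else 0)"
proof -
  have "(spin_rep n F_gen *\<^sub>v w) $ i =
      (\<Sum>k = 0..<Suc n. if k = i - 1 then (if i > 0 then of_nat i * w $ k else 0) else 0)"
    unfolding spin_rep_apply[OF assms] by (rule sum.cong) (use assms in auto)
  also have "\<dots> = (if i > 0 then of_nat i * w $ (i - 1) else 0)"
    using assms by (subst sum.delta) auto
  finally show ?thesis .
qed

lemma spin_rep_H_apply:
  assumes "w \<in> carrier_vec (n+1)" "i \<le> n"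
  shows "(spin_rep n H_gen *\<^sub>v w) $ i = (of_nat n - 2 * of_nat i) * w $ i"
proof -
  have "(spin_rep n H_gen *\<^sub>v w) $ i =
      (\<Sum>k = 0..<Suc n. if k = i then (of_nat n - 2 * of_nat i) * w $ k else 0)"
    unfolding spin_rep_apply[OF assms] by (rule sum.cong) (use assms in auto)
  also have "\<dots> = (of_nat n - 2 * of_nat i) * w $ i"
    using assms by (subst sum.delta) auto
  finally show ?thesis .
qed

lemma spin_rep_commutators:
  "spin_rep n H_gen * spin_rep n E_gen - spin_rep n E_gen * spin_rep n H_gen = 2 \<cdot>\<^sub>m spin_rep n E_gen"
  "spin_rep n H_gen * spin_rep n F_gen - spin_rep n F_gen * spin_rep n H_gen = (-2) \<cdot>\<^sub>m spin_rep n F_gen"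
  "spin_rep n E_gen * spin_rep n F_gen - spin_rep n F_gen * spin_rep n E_gen = spin_rep n H_gen"
proof -
  have cc: "col (spin_rep n y) k \<in> carrier_vec (n+1)" for y k
    by (metis carrier_vec_dim_vec dim_col dim_spin_rep(1))
  have ap: "(spin_rep n x * spin_rep n y) $$ (i,k) = (spin_rep n x *\<^sub>v col (spin_rep n y) k) $ i"
    if "i \<le> n" "k \<le> n" for x y i k
    using that dim_spin_rep[of n] by (simp del: spin_rep.simps)
  have ce: "col (spin_rep n y) k $ i = spin_rep n y $$ (i,k)" if "i \<le> n" "k \<le> n" for y i k
    using that dim_spin_rep[of n y] by (simp del: spin_rep.simps)
  note ev = ap spin_rep_E_apply[OF cc] spin_rep_F_apply[OF cc] spin_rep_H_apply[OF cc] ce dim_spin_rep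
  show "spin_rep n H_gen * spin_rep n E_gen - spin_rep n E_gen * spin_rep n H_gen = 2 \<cdot>\<^sub>m spin_rep n E_gen"
    by (rule eq_matI) (simp_all add: ev del: spin_rep.simps index_mult_mat(1) index_mult_mat_vec, auto simp: algebra_simps)
  show "spin_rep n H_gen * spin_rep n F_gen - spin_rep n F_gen * spin_rep n H_gen = (-2) \<cdot>\<^sub>m spin_rep n F_gen"
    by (rule eq_matI) (simp_all add: ev del: spin_rep.simps index_mult_mat(1) index_mult_mat_vec, auto simp: algebra_simps)
  show "spin_rep n E_gen * spin_rep n F_gen - spin_rep n F_gen * spin_rep n E_gen = spin_rep n H_gen"
    by (rule eq_matI)
      (simp_all add: ev del: spin_rep.simps index_mult_mat(1) index_mult_mat_vec, auto simp: algebra_simps of_nat_diff dest: less_antisym)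
qed

lemma spin_rep_irreducible:
  assumes W: "W \<subseteq> carrier_vec (n+1)" and z: "0\<^sub>v (n+1) \<in> W"
    and add: "\<And>v w. v \<in> W \<Longrightarrow> w \<in> W \<Longrightarrow> v + w \<in> W"
    and smult: "\<And>c v. v \<in> W \<Longrightarrow> c \<cdot>\<^sub>v v \<in> W"
    and inv: "\<And>x v. v \<in> W \<Longrightarrow> spin_rep n x *\<^sub>v v \<in> W"
  shows "W = {0\<^sub>v (n+1)} \<or> W = carrier_vec (n+1)"
proof (cases "W = {0\<^sub>v (n+1)}")
  case False
  then obtain w where w: "w \<in> W" "w \<noteq> 0\<^sub>v (n+1)" using z by blast
  have wc: "w \<in> carrier_vec (n+1)" using w W by blast
  have top: "unit_vec (n+1) 0 \<in> W"
    if "u \<in> W" "p \<le> n" "u $ p \<noteq> 0" "\<And>i. p < i \<Longrightarrow> i \<le> n \<Longrightarrow> u $ i = 0" for u p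
    using that
  proof (induction p arbitrary: u)
    case 0
    have uc: "u \<in> carrier_vec (n+1)" using 0 W by blast
    have "unit_vec (n+1) 0 = inverse (u $ 0) \<cdot>\<^sub>v u"
      using 0 uc by (intro eq_vecI) (auto simp: unit_vec_def)
    then show ?case using smult[OF 0(1)] by metis
  next
    case (Suc p)
    have uc: "u \<in> carrier_vec (n+1)" using Suc.prems W by blast
    show ?case
    proof (rule Suc.IH[of "spin_rep n E_gen *\<^sub>v u"])
      show "spin_rep n E_gen *\<^sub>v u \<in> W" using inv Suc.prems by blast
      show "p \<le> n" using Suc.prems by simp
      show "(spin_rep n E_gen *\<^sub>v u) $ p \<noteq> 0"
        using Suc.prems spin_rep_E_apply[OF uc, of p] by simp
      show "(spin_rep n E_gen *\<^sub>v u) $ i = 0" if "p < i" "i \<le> n" for i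
        using that Suc.prems(4)[of "i+1"] spin_rep_E_apply[OF uc, of i] by simp
    qed
  qed
  have "\<exists>i\<le>n. w $ i \<noteq> 0"
  proof (rule ccontr)
    assume "\<not> ?thesis"
    then have "w = 0\<^sub>v (n+1)" using wc by (intro eq_vecI) auto
    with w show False by simp
  qed
  then have S: "finite {i. i \<le> n \<and> w $ i \<noteq> 0}" "{i. i \<le> n \<and> w $ i \<noteq> 0} \<noteq> {}" by auto
  define p where "p = Max {i. i \<le> n \<and> w $ i \<noteq> 0}"
  have p: "p \<le> n" "w $ p \<noteq> 0" using Max_in[OF S] by (auto simp: p_def)
  have pm: "w $ i = 0" if "p < i" "i \<le> n" for i
    using Max_ge[OF S(1), of i] that unfolding p_def[symmetric] by auto
  have u0: "unit_vec (n+1) 0 \<in> W" by (rule top[OF w(1) p]) (rule pm)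
  have ui: "unit_vec (n+1) i \<in> W" if "i \<le> n" for i
    using that
  proof (induction i)
    case 0 show ?case by (rule u0)
  next
    case (Suc i)
    then have iW: "unit_vec (n+1) i \<in> W" by simp
    have "unit_vec (n+1) (Suc i) = inverse (of_nat (Suc i)) \<cdot>\<^sub>v (spin_rep n F_gen *\<^sub>v unit_vec (n+1) i)"
    proof (rule eq_vecI)
      show "dim_vec (unit_vec (n+1) (Suc i)) =
          dim_vec (inverse (of_nat (Suc i)) \<cdot>\<^sub>v (spin_rep n F_gen *\<^sub>v unit_vec (n+1) i))"
        by simp
    next
      fix k
      assume "k < dim_vec (inverse (of_nat (Suc i)) \<cdot>\<^sub>v (spin_rep n F_gen *\<^sub>v unit_vec (n+1) i))"
      then have k: "k \<le> n" by simp
      have "(spin_rep n F_gen *\<^sub>v unit_vec (n+1) i) $ k =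
          (if k > 0 then of_nat k * unit_vec (n+1) i $ (k - 1) else 0)"
        by (rule spin_rep_F_apply) (use k in auto)
      then have e: "(spin_rep n F_gen *\<^sub>v unit_vec (n+1) i) $ k = (if k = Suc i then of_nat (Suc i) else 0)"
        using k Suc.prems by (auto simp: unit_vec_def)
      have "of_nat (Suc i) \<noteq> (0::complex)" by (metis of_nat_eq_0_iff nat.distinct(1))
      then show "unit_vec (n+1) (Suc i) $ k =
          (inverse (of_nat (Suc i)) \<cdot>\<^sub>v (spin_rep n F_gen *\<^sub>v unit_vec (n+1) i)) $ k"
        using k Suc.prems by (subst index_smult_vec) (simp, simp only: e, simp add: unit_vec_def)
    qed
    then show ?case using smult[OF inv[OF iW]] by metis
  qed
  have "v \<in> W" if v: "v \<in> carrier_vec (n+1)" for v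
  proof -
    have "vec (n+1) (\<lambda>i. if i < k then v $ i else 0) \<in> W" if "k \<le> n+1" for k
      using that
    proof (induction k)
      case 0
      have "vec (n+1) (\<lambda>i. if i < 0 then v $ i else 0) = 0\<^sub>v (n+1)" by (intro eq_vecI) auto
      then show ?case using z by simp
    next
      case (Suc k)
      have "vec (n+1) (\<lambda>i. if i < Suc k then v $ i else 0) =
          vec (n+1) (\<lambda>i. if i < k then v $ i else 0) + v $ k \<cdot>\<^sub>v unit_vec (n+1) k"
        using Suc.prems by (intro eq_vecI) (auto simp: unit_vec_def dest: less_antisym)
      moreover have "\<dots> \<in> W"
        using Suc by (intro add smult ui) auto
      ultimately show ?case by simp
    qed
    from this[of "n+1"] have "vec (n+1) (\<lambda>i. if i < n+1 then v $ i else 0) \<in> W" by simp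
    also have "vec (n+1) (\<lambda>i. if i < n+1 then v $ i else 0) = v"
      using v by (intro eq_vecI) auto
    finally show ?thesis .
  qed
  then show ?thesis using W by blast
qed simp

end

theory Submission
  imports Defs
begin

text \<open>
  Scale the weight basis to \<open>(n - i)! v\<^sub>i = x\<^bsup>i\<^esup> / i!\<close>. The raising operator becomes \<open>d/dx\<close>, on a tensor
  product it becomes the sum of the partial derivatives, and a highest weight vector of level \<open>k \<le> n\<close>
  (the weight lowered \<open>k\<close> times from the top) is a translation-invariant homogeneous polynomial of
  degree \<open>k\<close>. In two factors the only one is \<open>(x - y)\<^bsup>k\<^esup>\<close>, up to a scalar; it generates the component
  of spin \<open>n - k\<close>, so \<open>R\<close> multiplies it by \<open>\<rho> k = r (n - k)\<close>. In three factors there are the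
  \<open>k + 1\<close> dimensional spaces of polynomials in \<open>x - y\<close> and \<open>y - z\<close>, preserved by \<open>R\<^sub>1\<^sub>2\<close> and \<open>R\<^sub>2\<^sub>3\<close>. The proof
  evaluates the braid relation on two or three vectors of such a space.

  An intertwiner that kills \<open>(x - y)\<^bsup>j\<^esup>\<close> for all \<open>j < k\<close> kills every vector of level below \<open>k\<close>, and on
  level \<open>k\<close> it only sees one coefficient, that of \<open>(x - y)\<^bsup>k\<^esup>\<close> modulo the image of the lowering
  operator (\<open>intertwiner_at\<close>). If \<open>m\<close> is the first level with \<open>\<rho> m = 1 + g \<noteq> 1\<close>, then on the span of
  \<open>(x - y)\<^bsup>m\<^esup>\<close> and \<open>(y - z)\<^bsup>m\<^esup>\<close> both \<open>R\<^sub>1\<^sub>2\<close> and \<open>R\<^sub>2\<^sub>3\<close> differ from the identity by an operator of rank one.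
  The coefficient of \<open>(x - y)\<^bsup>m\<^esup>\<close> in \<open>(y - z)\<^bsup>m\<^esup>\<close> that \<open>R\<^sub>1\<^sub>2\<close> sees is \<open>\<eta>\<^sub>m\<^sub>m\<close> up to sign, and the braid relation becomes
  \<open>1 + g + \<eta>\<^sub>m\<^sub>m\<^sup>2 g\<^sup>2 = 0\<close> (\<open>first_deviation\<close>). For \<open>m = 1\<close> this is \<open>(1 + g/2)\<^sup>2 = 0\<close>, so \<open>\<rho> 1 = -1\<close>.

  If also \<open>\<rho> (m + 1) = 1\<close>, then the same argument one level higher, for \<open>(x - y)\<^bsup>m\<^esup> (x + y - 2z)\<close> and
  its mirror image, gives the same equation with \<open>\<eta>\<^sub>m\<^sub>m\<close> multiplied by a number larger than \<open>1\<close>. The two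
  equations contradict each other (\<open>second_deviation\<close>).

  If \<open>\<rho> 1 = -1\<close>, compare \<open>R\<close> with the flip, whose eigenvalues are \<open>(-1)\<^bsup>k\<^esup>\<close>. Were \<open>k \<ge> 2\<close> the first
  level where they differ, then on the linearly independent vectors \<open>(x - y)\<^bsup>k\<^esup>\<close>, \<open>(y - z)\<^bsup>k\<^esup>\<close>,
  \<open>(x - z)\<^bsup>k\<^esup>\<close> the braid relation would force \<open>\<eta>\<^sub>k\<^sub>k = \<plusminus>1\<close>, but \<open>0 < \<eta>\<^sub>k\<^sub>k < 1\<close>
  (\<open>deviation_from_flip\<close>).
\<close>

section \<open>Tensors in coordinates\<close>

text \<open>
  A tensor is stored as the function of its coordinates in the weight basis, so that fixing one index
  of a three-factor tensor yields a two-factor tensor. Values at indices above \<open>n\<close> are junk: \<open>act\<close>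
  ignores those of its argument and returns \<open>0\<close> there.
\<close>

definition coords2 :: "nat \<Rightarrow> (nat \<Rightarrow> nat \<Rightarrow> complex) \<Rightarrow> complex vec" where
  "coords2 n W = vec ((n+1)^2) (\<lambda>I. W (I div (n+1)) (I mod (n+1)))"

definition coords3 :: "nat \<Rightarrow> (nat \<Rightarrow> nat \<Rightarrow> nat \<Rightarrow> complex) \<Rightarrow> complex vec" where
  "coords3 n T = vec ((n+1)^3) (\<lambda>I. T (I div (n+1)^2) (I div (n+1) mod (n+1)) (I mod (n+1)))"

definition act :: "nat \<Rightarrow> complex mat \<Rightarrow> (nat \<Rightarrow> nat \<Rightarrow> complex) \<Rightarrow> nat \<Rightarrow> nat \<Rightarrow> complex" where
  "act n X W i j = (if i \<le> n \<and> j \<le> n then (X *\<^sub>v coords2 n W) $ (i * (n+1) + j) else 0)"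

lemma pair_index:
  fixes a b d p :: nat
  assumes "a < p" "b < d"
  shows "a * d + b < p * d"
proof -
  have "a * d + b < Suc a * d" using assms by simp
  also have "\<dots> \<le> p * d" using assms by (intro mult_right_mono) auto
  finally show ?thesis .
qed

lemma sum_pair_index:
  fixes g :: "nat \<Rightarrow> 'a::comm_monoid_add"
  shows "(\<Sum>I<p * d. g I) = (\<Sum>a<p. \<Sum>b<d. g (a * d + b))"
proof (cases "d = 0")
  case False
  have "(\<Sum>I<p * d. g I) = (\<Sum>(a,b)\<in>{..<p} \<times> {..<d}. g (a * d + b))"
    by (rule sum.reindex_bij_witness[where i = "\<lambda>(a,b). a * d + b" and j = "\<lambda>I. (I div d, I mod d)"])
      (use False in \<open>auto simp: less_mult_imp_div_less pair_index\<close>)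
  then show ?thesis by (simp add: sum.cartesian_product)
qed simp

text \<open>
  A factor acting as the identity only contributes a spectator index, so the product is a
  matrix-vector product on each slice.
\<close>

lemma tensor_left_apply:
  assumes "A \<in> carrier_mat p p" "v \<in> carrier_vec (p * d)" "i < p" "j < d"
  shows "(tensor_mat A (1\<^sub>m d) *\<^sub>v v) $ (i * d + j) = (A *\<^sub>v vec p (\<lambda>a. v $ (a * d + j))) $ i"
proof -
  have "(tensor_mat A (1\<^sub>m d) *\<^sub>v v) $ (i * d + j) =
      (\<Sum>I<p * d. tensor_mat A (1\<^sub>m d) $$ (i * d + j, I) * v $ I)"
    using assms pair_index[of i p j d]
    by (simp add: scalar_prod_def tensor_mat_def atLeast0LessThan)
  also have "\<dots> = (\<Sum>a<p. \<Sum>b<d. A $$ (i,a) * (if b = j then v $ (a * d + b) else 0))"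
    unfolding sum_pair_index
    by (intro sum.cong refl) (use assms pair_index in \<open>auto simp: tensor_mat_def\<close>)
  also have "\<dots> = (\<Sum>a<p. A $$ (i,a) * v $ (a * d + j))"
    using assms by (simp add: sum.delta' flip: sum_distrib_left)
  also have "\<dots> = (A *\<^sub>v vec p (\<lambda>a. v $ (a * d + j))) $ i"
    using assms by (simp add: scalar_prod_def atLeast0LessThan)
  finally show ?thesis .
qed

lemma tensor_right_apply:
  assumes "B \<in> carrier_mat q q" "v \<in> carrier_vec (d * q)" "i < d" "j < q"
  shows "(tensor_mat (1\<^sub>m d) B *\<^sub>v v) $ (i * q + j) = (B *\<^sub>v vec q (\<lambda>b. v $ (i * q + b))) $ j"
proof -
  have "(tensor_mat (1\<^sub>m d) B *\<^sub>v v) $ (i * q + j) =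
      (\<Sum>I<d * q. tensor_mat (1\<^sub>m d) B $$ (i * q + j, I) * v $ I)"
    using assms pair_index[of i d j q]
    by (simp add: scalar_prod_def tensor_mat_def atLeast0LessThan)
  also have "\<dots> = (\<Sum>a<d. \<Sum>b<q. if a = i then B $$ (j,b) * v $ (i * q + b) else 0)"
    unfolding sum_pair_index
    by (intro sum.cong refl) (use assms pair_index in \<open>auto simp: tensor_mat_def\<close>)
  also have "\<dots> = (\<Sum>b<q. B $$ (j,b) * v $ (i * q + b))"
    using assms by (subst sum.swap) (simp add: sum.delta')
  also have "\<dots> = (B *\<^sub>v vec q (\<lambda>b. v $ (i * q + b))) $ j"
    using assms by (simp add: scalar_prod_def atLeast0LessThan)
  finally show ?thesis .
qed

lemma coords_carrier [simp]:
  "coords2 n W \<in> carrier_vec ((n+1)^2)" "coords3 n T \<in> carrier_vec ((n+1)^3)"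
  by (simp_all add: coords2_def coords3_def)

lemma coords2_index:
  assumes "i \<le> n" "j \<le> n"
  shows "coords2 n W $ (i * (n+1) + j) = W i j"
  using assms pair_index[of i "n+1" j "n+1"]
  by (simp add: coords2_def power2_eq_square del: mult_Suc mult_Suc_right)

lemma coords2_act:
  assumes "X \<in> carrier_mat ((n+1)^2) ((n+1)^2)"
  shows "coords2 n (act n X W) = X *\<^sub>v coords2 n W"
proof (rule eq_vecI)
  fix I assume "I < dim_vec (X *\<^sub>v coords2 n W)"
  then have I: "I < (n+1) * (n+1)" using assms by (simp add: power2_eq_square)
  then have "I div (n+1) \<le> n" "I mod (n+1) \<le> n"
    using less_mult_imp_div_less[OF I] mod_less_divisor[of "n+1" I] by simp_all
  then show "coords2 n (act n X W) $ I = (X *\<^sub>v coords2 n W) $ I"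
    using I by (simp add: coords2_def act_def power2_eq_square del: mult_Suc mult_Suc_right)
qed (use assms in \<open>simp add: coords2_def\<close>)

lemma coords3_index:
  assumes "i \<le> n" "j \<le> n" "l \<le> n"
  shows "coords3 n T $ ((i * (n+1) + j) * (n+1) + l) = T i j l"
proof -
  have a: "i * (n+1) + j < (n+1)^2"
    using pair_index[of i "n+1" j "n+1"] assms by (simp add: power2_eq_square)
  have "(i * (n+1) + j) * (n+1) + l < (n+1)^3"
    using pair_index[OF a, of l "n+1"] assms by (simp add: power3_eq_cube power2_eq_square)
  moreover have "((i * (n+1) + j) * (n+1) + l) div (n+1)^2 = i"
    using assms by (simp add: power2_eq_square div_mult2_eq del: mult_Suc mult_Suc_right)
  moreover have "((i * (n+1) + j) * (n+1) + l) div (n+1) mod (n+1) = j"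
    using assms by (simp del: mult_Suc mult_Suc_right)
  ultimately show ?thesis
    using assms by (simp add: coords3_def del: mult_Suc mult_Suc_right)
qed

lemma coords3_eqD:
  assumes "coords3 n T = coords3 n T'" "i \<le> n" "j \<le> n" "l \<le> n"
  shows "T i j l = T' i j l"
  using coords3_index[OF assms(2-4)] assms(1) by metis

lemma coords3_eqI:
  assumes v: "v \<in> carrier_vec ((n+1)^3)"
    and e: "\<And>i j l. i \<le> n \<Longrightarrow> j \<le> n \<Longrightarrow> l \<le> n \<Longrightarrow> v $ ((i * (n+1) + j) * (n+1) + l) = T i j l"
  shows "v = coords3 n T"
proof (rule eq_vecI)
  fix I assume "I < dim_vec (coords3 n T)"
  then have I: "I < (n+1) * (n+1) * (n+1)" by (simp add: coords3_def power3_eq_cube)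
  define i where "i = I div (n+1) div (n+1)"
  define j where "j = I div (n+1) mod (n+1)"
  define l where "l = I mod (n+1)"
  have "I = (i * (n+1) + j) * (n+1) + l" by (simp add: i_def j_def l_def del: mult_Suc mult_Suc_right)
  moreover have "i \<le> n" "j \<le> n" "l \<le> n"
    using less_mult_imp_div_less[OF less_mult_imp_div_less[OF I]]
      mod_less_divisor[of "n+1" I] mod_less_divisor[of "n+1" "I div (n+1)"]
    by (simp_all add: i_def j_def l_def)
  ultimately show "v $ I = coords3 n T $ I" using e coords3_index by metis
qed (use v in \<open>simp add: coords3_def\<close>)

definition on12 :: "((nat \<Rightarrow> nat \<Rightarrow> complex) \<Rightarrow> nat \<Rightarrow> nat \<Rightarrow> complex) \<Rightarrow>
    (nat \<Rightarrow> nat \<Rightarrow> nat \<Rightarrow> complex) \<Rightarrow> nat \<Rightarrow> nat \<Rightarrow> nat \<Rightarrow> complex" where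
  "on12 \<Phi> T = (\<lambda>i j l. \<Phi> (\<lambda>a b. T a b l) i j)"

definition on23 :: "((nat \<Rightarrow> nat \<Rightarrow> complex) \<Rightarrow> nat \<Rightarrow> nat \<Rightarrow> complex) \<Rightarrow>
    (nat \<Rightarrow> nat \<Rightarrow> nat \<Rightarrow> complex) \<Rightarrow> nat \<Rightarrow> nat \<Rightarrow> nat \<Rightarrow> complex" where
  "on23 \<Phi> T = (\<lambda>i. \<Phi> (T i))"

lemma op12_coords3:
  assumes X: "X \<in> carrier_mat ((n+1)^2) ((n+1)^2)"
  shows "op12 n X *\<^sub>v coords3 n T = coords3 n (on12 (act n X) T)"
proof (rule coords3_eqI)
  show "op12 n X *\<^sub>v coords3 n T \<in> carrier_vec ((n+1)^3)"
    by (rule carrier_vecI) (use X in \<open>simp add: op12_def tensor_mat_def power3_eq_cube power2_eq_square\<close>)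
next
  fix i j l assume ijl: "i \<le> n" "j \<le> n" "l \<le> n"
  have s: "vec ((n+1)^2) (\<lambda>a. coords3 n T $ (a * (n+1) + l)) = coords2 n (\<lambda>a b. T a b l)"
  proof (rule eq_vecI)
    fix I assume "I < dim_vec (coords2 n (\<lambda>a b. T a b l))"
    then have I: "I < (n+1)^2" by (simp add: coords2_def)
    have "I * (n+1) + l < (n+1)^3"
      using pair_index[OF I, of l "n+1"] ijl by (simp add: power3_eq_cube power2_eq_square)
    then show "vec ((n+1)^2) (\<lambda>a. coords3 n T $ (a * (n+1) + l)) $ I = coords2 n (\<lambda>a b. T a b l) $ I"
      using I ijl by (simp add: coords2_def coords3_def power2_eq_square div_mult2_eq del: mult_Suc mult_Suc_right)
  qed (simp add: coords2_def)
  have "(op12 n X *\<^sub>v coords3 n T) $ ((i * (n+1) + j) * (n+1) + l) = (X *\<^sub>v coords2 n (\<lambda>a b. T a b l)) $ (i * (n+1) + j)"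
    unfolding op12_def s[symmetric]
    by (rule tensor_left_apply[OF X])
      (use ijl pair_index[of i "n+1" j "n+1"] in \<open>simp_all add: coords3_def power2_eq_square power3_eq_cube\<close>)
  then show "(op12 n X *\<^sub>v coords3 n T) $ ((i * (n+1) + j) * (n+1) + l) = on12 (act n X) T i j l"
    using ijl by (simp add: on12_def act_def)
qed

lemma op23_coords3:
  assumes X: "X \<in> carrier_mat ((n+1)^2) ((n+1)^2)"
  shows "op23 n X *\<^sub>v coords3 n T = coords3 n (on23 (act n X) T)"
proof (rule coords3_eqI)
  show "op23 n X *\<^sub>v coords3 n T \<in> carrier_vec ((n+1)^3)"
    by (rule carrier_vecI) (use X in \<open>simp add: op23_def tensor_mat_def power3_eq_cube power2_eq_square\<close>)
next
  fix i j l assume ijl: "i \<le> n" "j \<le> n" "l \<le> n"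
  have s: "vec ((n+1)^2) (\<lambda>b. coords3 n T $ (i * (n+1)^2 + b)) = coords2 n (T i)"
  proof (rule eq_vecI)
    fix I assume "I < dim_vec (coords2 n (T i))"
    then have I: "I < (n+1) * (n+1)" by (simp add: coords2_def power2_eq_square)
    have lt: "I div (n+1) < n+1" "I mod (n+1) \<le> n"
      using less_mult_imp_div_less[OF I] mod_less_divisor[of "n+1" I] by simp_all
    have "i * (n+1)^2 + I = (i * (n+1) + I div (n+1)) * (n+1) + I mod (n+1)"
      by (simp add: power2_eq_square add_mult_distrib del: mult_Suc mult_Suc_right)
    then have "coords3 n T $ (i * (n+1)^2 + I) = T i (I div (n+1)) (I mod (n+1))"
      using coords3_index[of i n "I div (n+1)" "I mod (n+1)" T] lt ijl by simp
    then show "vec ((n+1)^2) (\<lambda>b. coords3 n T $ (i * (n+1)^2 + b)) $ I = coords2 n (T i) $ I"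
      using I by (simp add: coords2_def power2_eq_square del: mult_Suc mult_Suc_right)
  qed (simp add: coords2_def)
  have p: "j * (n+1) + l < (n+1)^2"
    using ijl pair_index[of j "n+1" l "n+1"] by (simp add: power2_eq_square)
  have "(op23 n X *\<^sub>v coords3 n T) $ (i * (n+1)^2 + (j * (n+1) + l)) = (X *\<^sub>v coords2 n (T i)) $ (j * (n+1) + l)"
    unfolding op23_def s[symmetric]
    by (rule tensor_right_apply[OF X])
      (use ijl p in \<open>simp_all add: coords3_def power2_eq_square power3_eq_cube\<close>)
  moreover have "i * (n+1)^2 + (j * (n+1) + l) = (i * (n+1) + j) * (n+1) + l"
    by (simp add: power2_eq_square algebra_simps)
  ultimately show "(op23 n X *\<^sub>v coords3 n T) $ ((i * (n+1) + j) * (n+1) + l) = on23 (act n X) T i j l"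
    using ijl by (simp only: on23_def act_def simp_thms if_True)
qed

text \<open>
  The matrix equation becomes an identity between slicewise actions; all later arguments use only this
  form.
\<close>

lemma braid_relation_coords:
  assumes X: "X \<in> carrier_mat ((n+1)^2) ((n+1)^2)"
    and YB: "op12 n X * op23 n X * op12 n X = op23 n X * op12 n X * op23 n X"
    and ijl: "i \<le> n" "j \<le> n" "l \<le> n"
  shows "on12 (act n X) (on23 (act n X) (on12 (act n X) T)) i j l =
    on23 (act n X) (on12 (act n X) (on23 (act n X) T)) i j l"
proof -
  have c12: "op12 n X \<in> carrier_mat ((n+1)^3) ((n+1)^3)" and c23: "op23 n X \<in> carrier_mat ((n+1)^3) ((n+1)^3)"
    using X by (auto simp: op12_def op23_def tensor_mat_def power3_eq_cube power2_eq_square)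
  have t: "(A * B * A) *\<^sub>v coords3 n T = A *\<^sub>v (B *\<^sub>v (A *\<^sub>v coords3 n T))"
    if "A \<in> carrier_mat ((n+1)^3) ((n+1)^3)" "B \<in> carrier_mat ((n+1)^3) ((n+1)^3)" for A B
    using that by (metis assoc_mult_mat_vec coords_carrier(2) mult_carrier_mat mult_mat_vec_carrier)
  have "coords3 n (on12 (act n X) (on23 (act n X) (on12 (act n X) T))) =
      coords3 n (on23 (act n X) (on12 (act n X) (on23 (act n X) T)))"
    using t[OF c12 c23] t[OF c23 c12] YB by (simp add: op12_coords3[OF X] op23_coords3[OF X])
  from coords3_eqD[OF this ijl] show ?thesis .
qed

lemma act_mult:
  assumes "X \<in> carrier_mat ((n+1)^2) ((n+1)^2)" "Y \<in> carrier_mat ((n+1)^2) ((n+1)^2)"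
  shows "act n (X * Y) W = act n X (act n Y W)"
  unfolding act_def[of n "X * Y"] act_def[of n X] coords2_act[OF assms(2)]
  by (simp only: assoc_mult_mat_vec[OF assms coords_carrier(1)])

lemma act_linear:
  assumes "X \<in> carrier_mat ((n+1)^2) ((n+1)^2)"
  shows "act n X (\<lambda>i j. a * W i j + b * U i j) = (\<lambda>i j. a * act n X W i j + b * act n X U i j)"
proof -
  have "coords2 n (\<lambda>i j. a * W i j + b * U i j) = a \<cdot>\<^sub>v coords2 n W + b \<cdot>\<^sub>v coords2 n U"
    by (rule eq_vecI) (auto simp: coords2_def)
  then have "X *\<^sub>v coords2 n (\<lambda>i j. a * W i j + b * U i j) =
      a \<cdot>\<^sub>v (X *\<^sub>v coords2 n W) + b \<cdot>\<^sub>v (X *\<^sub>v coords2 n U)"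
    by (simp only: mult_add_distrib_mat_vec[OF assms smult_carrier_vec[THEN iffD2, OF coords_carrier(1)] smult_carrier_vec[THEN iffD2, OF coords_carrier(1)]]
        mult_mat_vec[OF assms coords_carrier(1)])
  moreover have "i * (n+1) + j < (n+1)^2" if "i \<le> n" "j \<le> n" for i j
    using that pair_index[of i "n+1" j "n+1"] by (simp add: power2_eq_square)
  ultimately show ?thesis
    using assms by (intro ext) (simp add: act_def del: mult_Suc mult_Suc_right mult_mat_vec_def)
qed

lemma act_tensor_rep:
  "act n (tensor_rep n x) W i j = (if i \<le> n \<and> j \<le> n then
     (spin_rep n x *\<^sub>v vec (n+1) (\<lambda>a. W a j)) $ i + (spin_rep n x *\<^sub>v vec (n+1) (W i)) $ j else 0)"
proof (cases "i \<le> n \<and> j \<le> n")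
  case True
  have p: "i * (n+1) + j < (n+1)^2"
    using True pair_index[of i "n+1" j "n+1"] by (simp add: power2_eq_square)
  have s: "vec (n+1) (\<lambda>a. coords2 n W $ (a * (n+1) + j)) = vec (n+1) (\<lambda>a. W a j)"
    "vec (n+1) (\<lambda>b. coords2 n W $ (i * (n+1) + b)) = vec (n+1) (W i)"
    using True by (auto intro!: eq_vecI simp: coords2_index[unfolded Suc_eq_plus1[symmetric]] less_Suc_eq_le simp del: mult_Suc mult_Suc_right)
  have cc: "coords2 n W \<in> carrier_vec ((n+1) * (n+1))"
    using coords_carrier(1)[of n W] by (simp only: power2_eq_square)
  have c: "tensor_mat (spin_rep n x) (1\<^sub>m (n+1)) \<in> carrier_mat ((n+1)^2) ((n+1)^2)"
    "tensor_mat (1\<^sub>m (n+1)) (spin_rep n x) \<in> carrier_mat ((n+1)^2) ((n+1)^2)"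
    by (auto simp: tensor_mat_def power2_eq_square dim_spin_rep)
  have "(tensor_rep n x *\<^sub>v coords2 n W) $ (i * (n+1) + j) =
      (tensor_mat (spin_rep n x) (1\<^sub>m (n+1)) *\<^sub>v coords2 n W) $ (i * (n+1) + j) +
      (tensor_mat (1\<^sub>m (n+1)) (spin_rep n x) *\<^sub>v coords2 n W) $ (i * (n+1) + j)"
    unfolding tensor_rep_def add_mult_distrib_mat_vec[OF c coords_carrier(1)]
    by (rule index_add_vec(1)) (use c p in \<open>simp only: dim_mult_mat_vec carrier_matD\<close>)
  also have "\<dots> = (spin_rep n x *\<^sub>v vec (n+1) (\<lambda>a. W a j)) $ i + (spin_rep n x *\<^sub>v vec (n+1) (W i)) $ j"
    using True tensor_left_apply[OF spin_rep_carrier cc, of i j x] tensor_right_apply[OF spin_rep_carrier cc, of i j x]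
    by (simp only: s) (simp only: less_Suc_eq_le Suc_eq_plus1[symmetric])
  finally show ?thesis using True by (simp only: act_def simp_thms if_True)
qed (auto simp: act_def)

definition raise :: "nat \<Rightarrow> (nat \<Rightarrow> nat \<Rightarrow> complex) \<Rightarrow> nat \<Rightarrow> nat \<Rightarrow> complex" where
  "raise n W i j = (if i \<le> n \<and> j \<le> n then of_nat (n - i) * W (i + 1) j + of_nat (n - j) * W i (j + 1) else 0)"

definition lower :: "nat \<Rightarrow> (nat \<Rightarrow> nat \<Rightarrow> complex) \<Rightarrow> nat \<Rightarrow> nat \<Rightarrow> complex" where
  "lower n W i j = (if i \<le> n \<and> j \<le> n then of_nat i * W (i - 1) j + of_nat j * W i (j - 1) else 0)"

definition weigh :: "nat \<Rightarrow> (nat \<Rightarrow> nat \<Rightarrow> complex) \<Rightarrow> nat \<Rightarrow> nat \<Rightarrow> complex" where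
  "weigh n W i j = (if i \<le> n \<and> j \<le> n then (2 * of_nat n - 2 * of_nat i - 2 * of_nat j) * W i j else 0)"

lemma act_raise: "act n (tensor_rep n E_gen) W = raise n W"
  by (intro ext) (auto simp: act_tensor_rep raise_def spin_rep_E_apply simp del: spin_rep.simps index_mult_mat_vec)

lemma act_lower: "act n (tensor_rep n F_gen) W = lower n W"
  by (intro ext) (auto simp: act_tensor_rep lower_def spin_rep_F_apply simp del: spin_rep.simps index_mult_mat_vec)

lemma act_weigh: "act n (tensor_rep n H_gen) W = weigh n W"
  by (intro ext) (auto simp: act_tensor_rep weigh_def spin_rep_H_apply algebra_simps simp del: spin_rep.simps index_mult_mat_vec)

section \<open>Highest weight vectors and intertwiners\<close>

text \<open>
  Level \<open>k\<close> is the weight space of weight \<open>2n - 2k\<close>, together with the condition that the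
  coordinates above \<open>n\<close> vanish.
\<close>

definition level :: "nat \<Rightarrow> nat \<Rightarrow> (nat \<Rightarrow> nat \<Rightarrow> complex) \<Rightarrow> bool" where
  "level n k W \<longleftrightarrow> (\<forall>i j. n < i \<or> n < j \<or> i + j \<noteq> k \<longrightarrow> W i j = 0)"

text \<open>
  The polynomial \<open>(x - y)\<^bsup>k\<^esup> / k!\<close> under the identification \<open>(n - i)! v\<^sub>i = x\<^bsup>i\<^esup> / i!\<close>.
\<close>

definition hw :: "nat \<Rightarrow> nat \<Rightarrow> nat \<Rightarrow> nat \<Rightarrow> complex" where
  "hw n k i j = (if i + j = k then (-1) ^ j * fact (n - i) * fact (n - j) else 0)"

definition hw_norm :: "nat \<Rightarrow> nat \<Rightarrow> complex" where
  "hw_norm n k = (\<Sum>i\<le>k. of_nat (k choose i) * (fact (n - i) * fact (n - (k - i))))"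

text \<open>
  The linear functional on level \<open>k\<close> that vanishes on the image of the lowering operator and is \<open>1\<close> on
  \<open>hw n k\<close>. Vanishing on that image forces the weights \<open>(-1)\<^bsup>i\<^esup> binom(k, i)\<close> up to a scalar, and \<open>hw_norm\<close>
  is the value of the signed sum at \<open>hw n k\<close>.
\<close>

definition hw_coeff :: "nat \<Rightarrow> nat \<Rightarrow> (nat \<Rightarrow> nat \<Rightarrow> complex) \<Rightarrow> complex" where
  "hw_coeff n k W = (\<Sum>i\<le>k. (-1) ^ (k - i) * of_nat (k choose i) * W i (k - i)) / hw_norm n k"

text \<open>
  Intertwiners are taken as operators on coordinate functions, not as matrices, because the identity and
  the flip then need no truncation; the last clause makes them preserve vanishing above \<open>n\<close>.
\<close>

definition intertwiner :: "nat \<Rightarrow> ((nat \<Rightarrow> nat \<Rightarrow> complex) \<Rightarrow> nat \<Rightarrow> nat \<Rightarrow> complex) \<Rightarrow> bool" where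
  "intertwiner n \<Phi> \<longleftrightarrow>
     (\<forall>a b W U. \<Phi> (\<lambda>i j. a * W i j + b * U i j) = (\<lambda>i j. a * \<Phi> W i j + b * \<Phi> U i j)) \<and>
     (\<forall>W. \<Phi> (raise n W) = raise n (\<Phi> W)) \<and> (\<forall>W. \<Phi> (lower n W) = lower n (\<Phi> W)) \<and>
     (\<forall>W. \<Phi> (weigh n W) = weigh n (\<Phi> W)) \<and>
     (\<forall>W i j. (\<forall>i j. n < i \<or> n < j \<longrightarrow> W i j = 0) \<longrightarrow> n < i \<or> n < j \<longrightarrow> \<Phi> W i j = 0)"

lemma intertwiner_linear:
  "intertwiner n \<Phi> \<Longrightarrow> \<Phi> (\<lambda>i j. a * W i j + b * U i j) = (\<lambda>i j. a * \<Phi> W i j + b * \<Phi> U i j)"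
  by (simp add: intertwiner_def)

lemma intertwiner_scale: "intertwiner n \<Phi> \<Longrightarrow> \<Phi> (\<lambda>i j. a * W i j) = (\<lambda>i j. a * \<Phi> W i j)"
  using intertwiner_linear[of n \<Phi> a W 0 W] by simp

lemma intertwiner_zero_arg: "intertwiner n \<Phi> \<Longrightarrow> \<Phi> (\<lambda>i j. 0) = (\<lambda>i j. 0)"
  using intertwiner_scale[of n \<Phi> 0 "\<lambda>i j. 0"] by simp

lemma intertwiner_raise: "intertwiner n \<Phi> \<Longrightarrow> \<Phi> (raise n W) = raise n (\<Phi> W)"
  and intertwiner_lower: "intertwiner n \<Phi> \<Longrightarrow> \<Phi> (lower n W) = lower n (\<Phi> W)"
  by (simp_all add: intertwiner_def)

text \<open>
  Levels are eigenspaces of \<open>weigh\<close> for pairwise different eigenvalues.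
\<close>

lemma intertwiner_level:
  assumes \<Phi>: "intertwiner n \<Phi>" and W: "level n k W"
  shows "level n k (\<Phi> W)"
proof -
  have out: "\<Phi> W i j = 0" if "n < i \<or> n < j" for i j
    using \<Phi> W that unfolding intertwiner_def level_def by blast
  have "weigh n W = (\<lambda>i j. (2 * of_nat n - 2 * of_nat k) * W i j)"
  proof (intro ext)
    fix i j show "weigh n W i j = (2 * of_nat n - 2 * of_nat k) * W i j"
      using W by (cases "i + j = k") (auto simp: weigh_def level_def algebra_simps)
  qed
  then have "weigh n (\<Phi> W) = (\<lambda>i j. (2 * of_nat n - 2 * of_nat k) * \<Phi> W i j)"
    using \<Phi> intertwiner_scale[OF \<Phi>] unfolding intertwiner_def by metis
  then have e: "weigh n (\<Phi> W) i j = (2 * of_nat n - 2 * of_nat k) * \<Phi> W i j" for i j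
    by metis
  have "\<Phi> W i j = 0" if "i + j \<noteq> k" for i j
  proof (cases "i \<le> n \<and> j \<le> n")
    case True
    then have "2 * (of_nat (i + j) - of_nat k) * \<Phi> W i j = 0"
      using e[of i j] by (simp add: weigh_def algebra_simps)
    moreover have "2 * ((of_nat (i + j) :: complex) - of_nat k) \<noteq> 0"
      using that by (metis of_nat_eq_iff eq_iff_diff_eq_0 mult_eq_0_iff zero_neq_numeral)
    ultimately show ?thesis using mult_eq_0_iff by blast
  qed (use out in auto)
  then show ?thesis using out unfolding level_def by blast
qed

lemma raise_linear: "raise n (\<lambda>i j. a * W i j + b * U i j) = (\<lambda>i j. a * raise n W i j + b * raise n U i j)"
  and lower_linear: "lower n (\<lambda>i j. a * W i j + b * U i j) = (\<lambda>i j. a * lower n W i j + b * lower n U i j)"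
  and weigh_linear: "weigh n (\<lambda>i j. a * W i j + b * U i j) = (\<lambda>i j. a * weigh n W i j + b * weigh n U i j)"
  by (intro ext; simp add: raise_def lower_def weigh_def algebra_simps)+

lemma lower_zero: "lower n (\<lambda>i j. 0) = (\<lambda>i j. 0)"
  by (auto simp: lower_def fun_eq_iff)

lemma intertwiner_combination:
  assumes "intertwiner n \<Phi>" "intertwiner n \<Psi>"
  shows "intertwiner n (\<lambda>W i j. a * \<Phi> W i j + b * \<Psi> W i j)"
  using assms unfolding intertwiner_def raise_linear lower_linear weigh_linear
  by (simp add: algebra_simps)

lemma intertwiner_diff:
  assumes "intertwiner n \<Phi>" "intertwiner n \<Psi>"
  shows "intertwiner n (\<lambda>W i j. \<Phi> W i j - \<Psi> W i j)"
  using intertwiner_combination[OF assms, of 1 "-1"] by simp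

lemma intertwiner_id: "intertwiner n (\<lambda>W. W)"
  by (simp add: intertwiner_def)

lemma intertwiner_flip: "intertwiner n (\<lambda>W i j. W j i)"
  by (auto simp: intertwiner_def raise_def lower_def weigh_def fun_eq_iff)

lemma intertwiner_compose:
  assumes "intertwiner n \<Phi>" "intertwiner n \<Psi>"
  shows "intertwiner n (\<lambda>W. \<Phi> (\<Psi> W))"
  using assms unfolding intertwiner_def by simp

lemma intertwiner_sum:
  assumes "finite S" "\<And>s. s \<in> S \<Longrightarrow> intertwiner n (\<Phi> s)"
  shows "intertwiner n (\<lambda>W i j. \<Sum>s\<in>S. c s * \<Phi> s W i j)"
  using assms
proof (induction S)
  case empty
  show ?case using intertwiner_combination[OF intertwiner_id intertwiner_id, of n 0 0] by simp
next
  case (insert s S)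
  then show ?case
    using intertwiner_combination[of n "\<Phi> s" "\<lambda>W i j. \<Sum>s\<in>S. c s * \<Phi> s W i j" "c s" 1] by simp
qed

lemma intertwiner_act:
  assumes X: "X \<in> carrier_mat ((n+1)^2) ((n+1)^2)"
    and c: "\<And>x. X * tensor_rep n x = tensor_rep n x * X"
  shows "intertwiner n (act n X)"
proof -
  have t: "tensor_rep n x \<in> carrier_mat ((n+1)^2) ((n+1)^2)" for x
    by (auto simp: tensor_rep_def tensor_mat_def power2_eq_square dim_spin_rep)
  have "act n X (act n (tensor_rep n x) W) = act n (tensor_rep n x) (act n X W)" for x W
    using c act_mult[OF X t] act_mult[OF t X] by metis
  then show ?thesis
    unfolding intertwiner_def act_raise[symmetric] act_lower[symmetric] act_weigh[symmetric]
    using act_linear[OF X] by (auto simp: act_def)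
qed

lemma level_raise: "level n (Suc k) W \<Longrightarrow> level n k (raise n W)"
  by (auto simp: level_def raise_def)

lemma level_hw: "k \<le> n \<Longrightarrow> level n k (hw n k)"
  by (auto simp: level_def hw_def)

lemma raise_hw:
  assumes "k \<le> n"
  shows "raise n (hw n k) = (\<lambda>i j. 0)"
proof (intro ext)
  fix i j
  show "raise n (hw n k) i j = 0"
  proof (cases "Suc (i + j) = k")
    case True
    then have "n - i = Suc (n - Suc i)" "n - j = Suc (n - Suc j)" using assms by auto
    then have "fact (n - i) = of_nat (n - i) * (fact (n - Suc i) :: complex)"
      "fact (n - j) = of_nat (n - j) * (fact (n - Suc j) :: complex)"
      by (metis fact_Suc)+
    then show ?thesis using True by (simp add: raise_def hw_def)
  qed (auto simp: raise_def hw_def)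
qed

text \<open>
  Along an antidiagonal, \<open>raise n W = 0\<close> is a two-term recursion whose coefficients do not vanish, so its
  solution is fixed by the first entry. Above level \<open>n\<close> the antidiagonal enters the square at a boundary
  point, where the recursion already yields \<open>0\<close>.
\<close>

lemma hw_unique:
  assumes W: "level n k W" and E: "raise n W = (\<lambda>i j. 0)"
  shows "k \<le> n \<Longrightarrow> \<exists>c. W = (\<lambda>i j. c * hw n k i j)"
    and "n < k \<Longrightarrow> W = (\<lambda>i j. 0)"
proof -
  have E0: "of_nat (n - i) * W (Suc i) j + of_nat (n - j) * W i (Suc j) = 0" if "i \<le> n" "j \<le> n" for i j
    using fun_cong[OF fun_cong[OF E, of i], of j] that by (simp add: raise_def)
  show "\<exists>c. W = (\<lambda>i j. c * hw n k i j)" if k: "k \<le> n"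
  proof -
    define c where "c = W 0 k / hw n k 0 k"
    have "W i j = c * hw n k i j" if "i + j = k" for i j
      using that
    proof (induction i arbitrary: j)
      case 0 then show ?case by (simp add: c_def hw_def)
    next
      case (Suc i)
      have h: "of_nat (n - i) * hw n k (Suc i) j + of_nat (n - j) * hw n k i (Suc j) = 0"
        using fun_cong[OF fun_cong[OF raise_hw[OF k], of i], of j] Suc.prems k by (simp add: raise_def)
      have "W i (Suc j) = c * hw n k i (Suc j)" using Suc by simp
      then have "of_nat (n - i) * (W (Suc i) j - c * hw n k (Suc i) j) =
          (of_nat (n - i) * W (Suc i) j + of_nat (n - j) * W i (Suc j)) -
          c * (of_nat (n - i) * hw n k (Suc i) j + of_nat (n - j) * hw n k i (Suc j))"
        by (simp add: algebra_simps)
      also have "\<dots> = 0" using E0[of i j] h Suc.prems k by simp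
      finally show ?case using Suc.prems k by simp
    qed
    then have "W = (\<lambda>i j. c * hw n k i j)"
      using W by (intro ext) (auto simp: level_def hw_def)
    then show ?thesis by blast
  qed
  show "W = (\<lambda>i j. 0)" if k: "n < k"
  proof -
    have "W i j = 0" if "i + j = k" "i \<le> n" for i j
      using that
    proof (induction i arbitrary: j)
      case 0 then show ?case using W k by (auto simp: level_def)
    next
      case (Suc i)
      show ?case
      proof (cases "j \<le> n")
        case True
        then show ?thesis using E0[of i j] Suc by simp
      qed (use W in \<open>auto simp: level_def\<close>)
    qed
    then show ?thesis using W by (intro ext) (metis level_def not_le)
  qed
qed

lemma sum_choose_Suc:
  fixes g :: "nat \<Rightarrow> complex"
  shows "(\<Sum>i\<le>Suc k. of_nat (Suc k choose i) * g i) = (\<Sum>i\<le>k. of_nat (k choose i) * (g i + g (Suc i)))"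
proof -
  have "(\<Sum>i\<le>Suc k. of_nat (Suc k choose i) * g i) =
      g 0 + (\<Sum>i\<le>k. of_nat (k choose i) * g (Suc i)) + (\<Sum>i\<le>k. of_nat (k choose Suc i) * g (Suc i))"
    unfolding sum.atMost_Suc_shift by (simp add: sum.distrib algebra_simps)
  also have "g 0 + (\<Sum>i\<le>k. of_nat (k choose i) * g (Suc i)) + (\<Sum>i\<le>k. of_nat (k choose Suc i) * g (Suc i)) =
      (\<Sum>i\<le>Suc k. of_nat (k choose i) * g i) + (\<Sum>i\<le>k. of_nat (k choose i) * g (Suc i))"
    unfolding sum.atMost_Suc_shift by simp
  finally show ?thesis by (simp add: sum.distrib algebra_simps)
qed

text \<open>
  A form of the Vandermonde identity; Pascal's rule splits the sum for \<open>Suc k\<close> into the sums for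
  \<open>(Suc p, q)\<close> and \<open>(p, Suc q)\<close>.
\<close>

lemma sum_choose_fact:
  "(\<Sum>i\<le>k. of_nat (k choose i) * (fact (p + (k - i)) * fact (q + i))) =
    (fact p * fact q * fact (p + q + k + 1) / fact (p + q + 1) :: complex)"
proof (induction k arbitrary: p q)
  case (Suc k)
  have "(\<Sum>i\<le>Suc k. of_nat (Suc k choose i) * (fact (p + (Suc k - i)) * fact (q + i))) =
      (\<Sum>i\<le>k. of_nat (k choose i) * (fact (p + (Suc k - i)) * fact (q + i) + fact (p + (Suc k - Suc i)) * fact (q + Suc i)) :: complex)"
    by (rule sum_choose_Suc)
  also have "\<dots> = (\<Sum>i\<le>k. of_nat (k choose i) * (fact (Suc p + (k - i)) * fact (q + i))) +
      (\<Sum>i\<le>k. of_nat (k choose i) * (fact (p + (k - i)) * fact (Suc q + i)))"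
    unfolding sum.distrib[symmetric] by (rule sum.cong) (auto simp: Suc_diff_le algebra_simps)
  also have "\<dots> = (fact (Suc p) * fact q + fact p * fact (Suc q)) * fact (p + q + Suc k + 1) / fact (p + q + 2)"
    unfolding Suc.IH by (simp add: add_divide_distrib algebra_simps)
  also have "fact (Suc p) * fact q + fact p * fact (Suc q) = (of_nat (p + q + 2) * (fact p * fact q) :: complex)"
    by (simp add: algebra_simps)
  also have "fact (p + q + 2) = (of_nat (p + q + 2) * fact (p + q + 1) :: complex)"
    by (metis Suc_1 Suc_eq_plus1 add_Suc_right fact_Suc)
  finally have "(\<Sum>i\<le>Suc k. of_nat (Suc k choose i) * (fact (p + (Suc k - i)) * fact (q + i))) =
      of_nat (p + q + 2) * (fact p * fact q) * fact (p + q + Suc k + 1) / (of_nat (p + q + 2) * fact (p + q + 1) :: complex)" .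
  moreover have "(of_nat (p + q + 2) :: complex) \<noteq> 0" by (simp only: of_nat_eq_0_iff)
  ultimately show ?case by (simp only: mult.assoc mult_divide_mult_cancel_left if_False simp_thms)
qed (simp del: fact_Suc)

lemma hw_norm_closed:
  assumes "k \<le> n"
  shows "hw_norm n k = fact (n - k) ^ 2 * fact (2 * n - k + 1) / fact (2 * n - 2 * k + 1)"
proof -
  have "hw_norm n k = (\<Sum>i\<le>k. of_nat (k choose i) * (fact (n - k + (k - i)) * fact (n - k + i)))"
    unfolding hw_norm_def by (rule sum.cong) (use assms in auto)
  also have "\<dots> = fact (n - k) * fact (n - k) * fact (n - k + (n - k) + k + 1) / fact (n - k + (n - k) + 1)"
    by (rule sum_choose_fact)
  also have "n - k + (n - k) + k + 1 = 2 * n - k + 1" using assms by simp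
  also have "n - k + (n - k) + 1 = 2 * n - 2 * k + 1" by simp
  finally show ?thesis by (simp add: power2_eq_square)
qed

lemma hw_norm_nonzero: "k \<le> n \<Longrightarrow> hw_norm n k \<noteq> 0"
  by (simp add: hw_norm_closed del: fact_Suc)

text \<open>
  This is where \<open>\<eta>\<^sub>k\<^sub>k\<close> comes from: up to sign, \<open>n! (n - k)!\<close> is the extreme coordinate of \<open>hw n k\<close>, so
  \<open>\<eta>\<^sub>k\<^sub>k\<close> is the value of \<open>hw_coeff\<close> on the part of \<open>hw n k\<close> supported there.
\<close>

lemma eta_hw_norm:
  assumes "k \<le> n"
  shows "eta n k = fact n * fact (n - k) / hw_norm n k"
  unfolding eta_def hw_norm_closed[OF assms] by (simp add: power2_eq_square del: fact_Suc)

lemma eta_nonzero: "eta n k \<noteq> 0"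
  by (simp add: eta_def del: fact_Suc)

text \<open>
  Among the positive terms of \<open>hw_norm n k\<close>, those for \<open>i = 0\<close> and \<open>i = k\<close> both equal \<open>n! (n - k)!\<close>.
\<close>

lemma norm_eta_less_one:
  assumes "0 < k" "k \<le> n"
  shows "norm (eta n k) < 1"
proof -
  define t :: "nat \<Rightarrow> real" where "t i = of_nat (k choose i) * (fact (n - i) * fact (n - (k - i)))" for i
  have N: "hw_norm n k = of_real (\<Sum>i\<le>k. t i)"
    by (simp add: hw_norm_def t_def)
  have pos: "0 \<le> t i" for i by (simp add: t_def)
  have "t 0 + t k = (\<Sum>i\<in>{0,k}. t i)" using assms by simp
  also have "\<dots> \<le> (\<Sum>i\<le>k. t i)" by (rule sum_mono2) (use pos in auto)
  finally have le: "2 * (fact n * fact (n - k)) \<le> (\<Sum>i\<le>k. t i)" by (simp add: t_def)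
  have p: "0 < fact n * (fact (n - k) :: real)" by simp
  have "norm (eta n k) = (fact n * fact (n - k)) / (\<Sum>i\<le>k. t i)"
    unfolding eta_hw_norm[OF assms(2)] N norm_divide norm_mult norm_fact norm_of_real
    using sum_nonneg[of "{..k}" t] pos by simp
  also have "\<dots> < 1"
  proof -
    have "0 < (\<Sum>i\<le>k. t i)" "fact n * fact (n - k) < (\<Sum>i\<le>k. t i)" using le p by linarith+
    then show ?thesis by simp
  qed
  finally show ?thesis .
qed

lemma hw_coeff_hw:
  assumes "k \<le> n"
  shows "hw_coeff n k (hw n k) = 1"
proof -
  have "(\<Sum>i\<le>k. (-1) ^ (k - i) * of_nat (k choose i) * hw n k i (k - i)) = hw_norm n k"
    unfolding hw_norm_def
  proof (rule sum.cong)
    fix i assume "i \<in> {..k}"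
    have "(-1) ^ (k - i) * (-1) ^ (k - i) = (1::complex)" by (simp flip: power_mult_distrib)
    then show "(-1) ^ (k - i) * of_nat (k choose i) * hw n k i (k - i) =
        of_nat (k choose i) * (fact (n - i) * fact (n - (k - i)))"
      using \<open>i \<in> {..k}\<close> by (simp add: hw_def mult_ac)
  qed simp
  then show ?thesis using hw_norm_nonzero[OF assms] by (simp add: hw_coeff_def)
qed

lemma hw_coeff_linear:
  "hw_coeff n k (\<lambda>i j. a * W i j + b * U i j) = a * hw_coeff n k W + b * hw_coeff n k U"
  by (simp add: hw_coeff_def sum_distrib_left sum.distrib[symmetric] algebra_simps flip: add_divide_distrib)

text \<open>
  Solving \<open>lower n U = W\<close> from one end of the antidiagonal to the other expresses \<open>U\<close> through alternating
  partial sums of \<open>W\<close>. The equation at the far end is the only obstruction, and it is the vanishing of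
  the full alternating sum.
\<close>

lemma lower_surj:
  assumes k: "k \<le> n" and W: "level n k W" and z: "hw_coeff n k W = 0"
  obtains U where "\<And>i j. Suc (i + j) \<noteq> k \<Longrightarrow> U i j = 0" "W = lower n U"
proof -
  (* The solution of the recursion: its numerators are the alternating partial sums S. *)
  define S where "S i = (\<Sum>t\<le>i. (-1) ^ t * of_nat (k choose t) * W t (k - t))" for i
  define U where "U i j = (if Suc (i + j) = k then (-1) ^ i / of_nat ((k choose i) * (k - i)) * S i else 0)" for i j
  have "(-1) ^ k * S k = (\<Sum>i\<le>k. (-1) ^ (k - i) * of_nat (k choose i) * W i (k - i))"
    unfolding S_def sum_distrib_left
  proof (rule sum.cong)
    fix i assume "i \<in> {..k}"
    then have "(-1) ^ k * (-1) ^ i = ((-1) ^ (k - i) :: complex)"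
      by (metis atMost_iff le_add_diff_inverse2 left_minus_one_mult_self mult.commute power_add)
    then show "(-1) ^ k * ((-1) ^ i * of_nat (k choose i) * W i (k - i)) =
        (-1) ^ (k - i) * of_nat (k choose i) * W i (k - i)"
      by (simp add: mult.assoc[symmetric])
  qed simp
  then have Sk: "S k = 0" using z hw_norm_nonzero[OF k] by (simp add: hw_coeff_def)
  have right: "of_nat j * U i (j - 1) = (-1) ^ i / of_nat (k choose i) * S i" if "i + j = k" for i j
  proof (cases j)
    case 0 then show ?thesis using Sk that by simp
  next
    case (Suc j')
    then have "Suc (i + (j - 1)) = k" "k - i = j" using that by simp_all
    then have "U i (j - 1) = (-1) ^ i / (of_nat (k choose i) * of_nat j) * S i"
      by (simp only: U_def of_nat_mult if_True simp_thms)
    moreover have "of_nat j \<noteq> (0::complex)" using Suc by (simp only: of_nat_eq_0_iff)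
    ultimately show ?thesis by simp
  qed
  have left: "of_nat (Suc i) * U i j = (-1) ^ i / of_nat (k choose Suc i) * S i" if "Suc i + j = k" for i j
  proof -
    have "Suc i * (k choose Suc i) = (k choose i) * (k - i)"
      by (metis binomial_absorb_comp binomial_absorption mult.commute)
    then have e: "(of_nat ((k choose i) * (k - i)) :: complex) = of_nat (Suc i) * of_nat (k choose Suc i)"
      by (simp only: of_nat_mult[symmetric])
    have "U i j = (-1) ^ i / (of_nat (Suc i) * of_nat (k choose Suc i)) * S i"
      unfolding U_def e using that by (simp del: of_nat_Suc)
    moreover have "of_nat (Suc i) \<noteq> (0::complex)" by (simp only: of_nat_eq_0_iff)
    ultimately show ?thesis by (simp del: of_nat_Suc)
  qed
  have "lower n U i j = W i j" for i j
  proof (cases "i + j = k")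
    case True
    then have c0: "of_nat (k choose i) \<noteq> (0::complex)" by simp
    have sq: "(-1) ^ t * ((-1) ^ t * x) = (x::complex)" for t x
      by (simp add: mult.assoc[symmetric] flip: power_mult_distrib)
    show ?thesis
    proof (cases i)
      case 0
      then show ?thesis using True k right[of 0 j] by (simp add: lower_def S_def)
    next
      case (Suc i')
      have "lower n U i j = (-1) ^ i' / of_nat (k choose i) * S i' + (-1) ^ i / of_nat (k choose i) * S i"
        using True k Suc left[of i' j] right[of i j] by (simp add: lower_def)
      also have "\<dots> = (-1) ^ i / of_nat (k choose i) * (S i - S i')"
        using Suc by (simp add: right_diff_distrib)
      also have "S i - S i' = (-1) ^ i * of_nat (k choose i) * W i (k - i)" using Suc by (simp add: S_def)
      also have "(-1) ^ i / of_nat (k choose i) * ((-1) ^ i * of_nat (k choose i) * W i (k - i)) = W i (k - i)"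
        using c0 sq[of i "W i (k - i)"] by simp
      finally show ?thesis using True by (metis add_diff_cancel_left')
    qed
  next
    case False
    then have "lower n U i j = 0" by (cases i; cases j) (auto simp: lower_def U_def)
    then show ?thesis using W False by (simp add: level_def)
  qed
  then have "W = lower n U" by (intro ext) simp
  moreover have "U i j = 0" if "Suc (i + j) \<noteq> k" for i j using that by (simp add: U_def)
  ultimately show ?thesis using that by blast
qed

text \<open>
  Level \<open>k \<le> n\<close> is the line of \<open>hw n k\<close> plus the image of the previous level under the lowering operator.
  For \<open>k = 0\<close> the condition on \<open>U\<close> makes it zero.
\<close>

lemma level_decomposition:
  assumes k: "k \<le> n" and W: "level n k W"
  obtains U where "\<And>i j. Suc (i + j) \<noteq> k \<Longrightarrow> U i j = 0"
    "W = (\<lambda>i j. hw_coeff n k W * hw n k i j + 1 * lower n U i j)"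
proof -
  define V where "V = (\<lambda>i j. 1 * W i j + (- hw_coeff n k W) * hw n k i j)"
  have "level n k V" using W level_hw[OF k] by (simp add: V_def level_def)
  moreover have "hw_coeff n k V = 0"
    unfolding V_def hw_coeff_linear hw_coeff_hw[OF k] by simp
  ultimately obtain U where U: "\<And>i j. Suc (i + j) \<noteq> k \<Longrightarrow> U i j = 0" "V = lower n U"
    using lower_surj[OF k] by blast
  have "W = (\<lambda>i j. hw_coeff n k W * hw n k i j + 1 * V i j)" by (simp add: V_def)
  then show ?thesis using that U by metis
qed

lemma intertwiner_below:
  assumes \<Phi>: "intertwiner n \<Phi>" and z: "\<And>j. j < k \<Longrightarrow> \<Phi> (hw n j) = (\<lambda>i j. 0)"
    and "k \<le> Suc n" "l < k" "level n l W"
  shows "\<Phi> W = (\<lambda>i j. 0)"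
  using assms(4,5)
proof (induction l arbitrary: W rule: less_induct)
  case (less l)
  then have l: "l \<le> n" using \<open>k \<le> Suc n\<close> by simp
  obtain U where U: "\<And>i j. Suc (i + j) \<noteq> l \<Longrightarrow> U i j = 0"
    "W = (\<lambda>i j. hw_coeff n l W * hw n l i j + 1 * lower n U i j)"
    using level_decomposition[OF l less.prems(2)] by blast
  have "\<Phi> U = (\<lambda>i j. 0)"
  proof (cases l)
    case 0
    then have "U = (\<lambda>i j. 0)" using U(1) by (intro ext) simp
    then show ?thesis using intertwiner_zero_arg[OF \<Phi>] by simp
  next
    case (Suc l')
    then have "level n l' U" using U(1) l by (auto simp: level_def)
    then show ?thesis using less.IH[of l'] less.prems Suc by simp
  qed
  moreover have "\<Phi> W = (\<lambda>i j. hw_coeff n l W * \<Phi> (hw n l) i j + 1 * lower n (\<Phi> U) i j)"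
    using intertwiner_linear[OF \<Phi>, of "hw_coeff n l W" "hw n l" 1 "lower n U"]
      intertwiner_lower[OF \<Phi>, of U] U(2) by metis
  ultimately show ?case using z[OF less.prems(1)] by (simp add: lower_zero)
qed

text \<open>
  The rank one principle: on the first level where an intertwiner does not vanish on the highest weight
  vector, it factors through \<open>hw_coeff\<close>.
\<close>

lemma intertwiner_at:
  assumes \<Phi>: "intertwiner n \<Phi>" and z: "\<And>j. j < k \<Longrightarrow> \<Phi> (hw n j) = (\<lambda>i j. 0)"
    and k: "k \<le> n" and W: "level n k W"
  shows "\<Phi> W = (\<lambda>i j. hw_coeff n k W * \<Phi> (hw n k) i j)"
proof -
  obtain U where U: "\<And>i j. Suc (i + j) \<noteq> k \<Longrightarrow> U i j = 0"
    "W = (\<lambda>i j. hw_coeff n k W * hw n k i j + 1 * lower n U i j)"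
    using level_decomposition[OF k W] by blast
  have "\<Phi> U = (\<lambda>i j. 0)"
  proof (cases k)
    case 0
    then have "U = (\<lambda>i j. 0)" using U(1) by (intro ext) simp
    then show ?thesis using intertwiner_zero_arg[OF \<Phi>] by simp
  next
    case (Suc k')
    then have "level n k' U" using U(1) k by (auto simp: level_def)
    then show ?thesis using intertwiner_below[OF \<Phi> z _ _ , of k k' U] Suc k by simp
  qed
  moreover have "\<Phi> W = (\<lambda>i j. hw_coeff n k W * \<Phi> (hw n k) i j + 1 * lower n (\<Phi> U) i j)"
    using intertwiner_linear[OF \<Phi>, of "hw_coeff n k W" "hw n k" 1 "lower n U"]
      intertwiner_lower[OF \<Phi>, of U] U(2) by metis
  ultimately show ?thesis by (simp add: lower_zero)
qed

text \<open>
  Complete reducibility in the form needed here. Levels up to \<open>n\<close> are generated by highest weight vectors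
  and lowering. Above level \<open>n\<close> the raising operator is injective, which transports the vanishing from
  one level to the next.
\<close>

lemma intertwiner_eq_zero:
  assumes \<Phi>: "intertwiner n \<Phi>" and z: "\<And>j. j \<le> n \<Longrightarrow> \<Phi> (hw n j) = (\<lambda>i j. 0)" and W: "level n l W"
  shows "\<Phi> W = (\<lambda>i j. 0)"
  using W
proof (induction l arbitrary: W)
  case 0
  show ?case by (rule intertwiner_below[OF \<Phi>, of "Suc n" 0]) (use z 0 in auto)
next
  case (Suc l)
  show ?case
  proof (cases "Suc l \<le> n")
    case True
    show ?thesis by (rule intertwiner_below[OF \<Phi>, of "Suc n" "Suc l"]) (use z Suc True in auto)
  next
    case False
    have "raise n (\<Phi> W) = (\<lambda>i j. 0)"
      using Suc.IH[OF level_raise[OF Suc.prems]] intertwiner_raise[OF \<Phi>] by metis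
    then show ?thesis
      using hw_unique(2)[OF intertwiner_level[OF \<Phi> Suc.prems]] False by simp
  qed
qed

lemma raise_lower_commutator:
  assumes "i \<le> n" "j \<le> n"
  shows "raise n (lower n W) i j = lower n (raise n W) i j + weigh n W i j"
proof -
  have nn: "of_nat (n - i) = (of_nat n - of_nat i :: complex)" "of_nat (n - j) = (of_nat n - of_nat j :: complex)"
    using assms by (simp_all add: of_nat_diff)
  (* At the border of the square the truncation in lower and raise is harmless,
     because the factor in front vanishes. *)
  have 1: "of_nat (n - i) * lower n W (Suc i) j = of_nat (n - i) * (of_nat (Suc i) * W i j + of_nat j * W (Suc i) (j - 1))"
    using assms by (cases "i = n") (auto simp: lower_def)
  have 2: "of_nat (n - j) * lower n W i (Suc j) = of_nat (n - j) * (of_nat i * W (i - 1) (Suc j) + of_nat (Suc j) * W i j)"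
    using assms by (cases "j = n") (auto simp: lower_def)
  have 3: "of_nat i * raise n W (i - 1) j = of_nat i * ((of_nat (n - i) + 1) * W i j + of_nat (n - j) * W (i - 1) (Suc j))"
  proof (cases i)
    case (Suc i')
    then have "n - i' = Suc (n - i)" using assms by simp
    then show ?thesis using assms Suc by (simp add: raise_def add.commute)
  qed simp
  have 4: "of_nat j * raise n W i (j - 1) = of_nat j * (of_nat (n - i) * W (Suc i) (j - 1) + (of_nat (n - j) + 1) * W i j)"
  proof (cases j)
    case (Suc j')
    then have "n - j' = Suc (n - j)" using assms by simp
    then show ?thesis using assms Suc by (simp add: raise_def add.commute)
  qed simp
  have "raise n (lower n W) i j = of_nat (n - i) * lower n W (Suc i) j + of_nat (n - j) * lower n W i (Suc j)"
    using assms by (simp add: raise_def[of n "lower n W"])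
  also have "\<dots> = of_nat i * raise n W (i - 1) j + of_nat j * raise n W i (j - 1) +
      (2 * of_nat n - 2 * of_nat i - 2 * of_nat j) * W i j"
    unfolding 1 2 3 4 unfolding nn of_nat_Suc by (simp add: algebra_simps)
  also have "of_nat i * raise n W (i - 1) j + of_nat j * raise n W i (j - 1) = lower n (raise n W) i j"
    using assms by (simp add: lower_def[of n "raise n W"])
  finally show ?thesis using assms by (simp add: weigh_def)
qed

lemma raise_lower_hw:
  assumes "k \<le> n"
  shows "raise n (lower n (hw n k)) = (\<lambda>i j. 2 * of_nat (n - k) * hw n k i j)"
proof (intro ext)
  fix i j
  show "raise n (lower n (hw n k)) i j = 2 * of_nat (n - k) * hw n k i j"
  proof (cases "i \<le> n \<and> j \<le> n")
    case True
    have "raise n (lower n (hw n k)) i j = weigh n (hw n k) i j"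
      using raise_lower_commutator[of i n j "hw n k"] True unfolding raise_hw[OF assms] by (simp add: lower_def)
    also have "\<dots> = 2 * of_nat (n - k) * hw n k i j"
    proof (cases "i + j = k")
      case True
      then show ?thesis using assms \<open>i \<le> n \<and> j \<le> n\<close> by (auto simp: weigh_def of_nat_diff)
    qed (simp add: weigh_def hw_def)
    finally show ?thesis .
  qed (use assms in \<open>auto simp: raise_def hw_def\<close>)
qed

text \<open>
  One level above \<open>k\<close>, if the new highest weight vector is killed as well, the values lie on the line
  of \<open>lower n (hw n k)\<close>; applying the raising operator, which sends that vector to \<open>2 (n - k)\<close>
  times \<open>hw n k\<close>, identifies the factor.
\<close>

lemma intertwiner_next:
  assumes \<Phi>: "intertwiner n \<Phi>" and z: "\<And>j. j < k \<Longrightarrow> \<Phi> (hw n j) = (\<lambda>i j. 0)"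
    and k: "k < n" and g: "\<Phi> (hw n k) = (\<lambda>i j. g * hw n k i j)"
    and s: "\<Phi> (hw n (Suc k)) = (\<lambda>i j. 0)" and W: "level n (Suc k) W"
  shows "\<Phi> W = (\<lambda>i j. g * hw_coeff n k (raise n W) / (2 * of_nat (n - k)) * lower n (hw n k) i j)"
proof -
  have k': "Suc k \<le> n" "k \<le> n" using k by auto
  obtain U where U: "\<And>i j. Suc (i + j) \<noteq> Suc k \<Longrightarrow> U i j = 0"
    "W = (\<lambda>i j. hw_coeff n (Suc k) W * hw n (Suc k) i j + 1 * lower n U i j)"
    using level_decomposition[OF k'(1) W] by blast
  define u where "u = g * hw_coeff n k U"
  have "level n k U" using U(1) k by (auto simp: level_def)
  then have "\<Phi> U = (\<lambda>i j. u * hw n k i j)"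
    using intertwiner_at[OF \<Phi> z k'(2)] g by (simp add: u_def mult_ac)
  moreover have "\<Phi> W = (\<lambda>i j. hw_coeff n (Suc k) W * \<Phi> (hw n (Suc k)) i j + 1 * lower n (\<Phi> U) i j)"
    using intertwiner_linear[OF \<Phi>, of "hw_coeff n (Suc k) W" "hw n (Suc k)" 1 "lower n U"]
      intertwiner_lower[OF \<Phi>, of U] U(2) by metis
  ultimately have eq: "\<Phi> W = (\<lambda>i j. u * lower n (hw n k) i j)"
    using s lower_linear[of n u "hw n k" 0 "hw n k"] by simp
  then have "raise n (\<Phi> W) = (\<lambda>i j. u * raise n (lower n (hw n k)) i j)"
    using raise_linear[of n u "lower n (hw n k)" 0 "hw n k"] by simp
  also have "\<dots> = (\<lambda>i j. u * (2 * of_nat (n - k) * hw n k i j))"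
    using raise_lower_hw[OF k'(2)] by simp
  finally have 1: "raise n (\<Phi> W) 0 k = u * (2 * of_nat (n - k) * hw n k 0 k)" by simp
  have "raise n (\<Phi> W) = (\<lambda>i j. hw_coeff n k (raise n W) * \<Phi> (hw n k) i j)"
    using intertwiner_at[OF \<Phi> z k'(2) level_raise[OF W]] intertwiner_raise[OF \<Phi>] by simp
  then have "raise n (\<Phi> W) 0 k = hw_coeff n k (raise n W) * g * hw n k 0 k" by (simp add: g)
  moreover have "hw n k 0 k \<noteq> 0" by (simp add: hw_def)
  ultimately have "u * (2 * of_nat (n - k)) = g * hw_coeff n k (raise n W)"
    using 1 by (simp add: mult_ac)
  then have "u = g * hw_coeff n k (raise n W) / (2 * of_nat (n - k))"
    using k by (simp add: eq_divide_eq)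
  then show ?thesis using eq by simp
qed

section \<open>Spin projectors\<close>

definition entries2 :: "nat \<Rightarrow> complex vec \<Rightarrow> nat \<Rightarrow> nat \<Rightarrow> complex" where
  "entries2 n v i j = (if i \<le> n \<and> j \<le> n then v $ (i * (n+1) + j) else 0)"

lemma act_eq_entries2: "act n X W = entries2 n (X *\<^sub>v coords2 n W)"
  by (intro ext) (simp only: act_def entries2_def)

lemma coords2_entries2:
  assumes "v \<in> carrier_vec ((n+1)^2)"
  shows "coords2 n (entries2 n v) = v"
proof (rule eq_vecI)
  fix I assume "I < dim_vec v"
  then have I: "I < (n+1) * (n+1)" using assms by (simp add: power2_eq_square)
  then have "I div (n+1) \<le> n" "I mod (n+1) \<le> n"
    using less_mult_imp_div_less[OF I] mod_less_divisor[of "n+1" I] by simp_all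
  then show "coords2 n (entries2 n v) $ I = v $ I"
    using I by (simp add: coords2_def entries2_def power2_eq_square del: mult_Suc mult_Suc_right)
qed (use assms in \<open>simp add: coords2_def\<close>)

lemma act_entries2: "v \<in> carrier_vec ((n+1)^2) \<Longrightarrow> act n X (entries2 n v) = entries2 n (X *\<^sub>v v)"
  by (simp only: act_eq_entries2 coords2_entries2)

lemma entries2_zero: "entries2 n (0\<^sub>v ((n+1)^2)) = (\<lambda>i j. 0)"
proof -
  have "i * (n+1) + j < (n+1)^2" if "i \<le> n" "j \<le> n" for i j
    using that pair_index[of i "n+1" j "n+1"] by (simp add: power2_eq_square)
  then show ?thesis by (intro ext) (simp add: entries2_def del: mult_Suc mult_Suc_right)
qed

lemma entries2_smult:
  "v \<in> carrier_vec ((n+1)^2) \<Longrightarrow> entries2 n (c \<cdot>\<^sub>v v) = (\<lambda>i j. c * entries2 n v i j)"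
proof -
  assume "v \<in> carrier_vec ((n+1)^2)"
  moreover have "i * (n+1) + j < (n+1)^2" if "i \<le> n" "j \<le> n" for i j
    using that pair_index[of i "n+1" j "n+1"] by (simp add: power2_eq_square)
  ultimately show ?thesis by (intro ext) (simp add: entries2_def del: mult_Suc mult_Suc_right)
qed

lemma spin_highest_weight:
  "spin_rep m E_gen *\<^sub>v unit_vec (m+1) 0 = 0\<^sub>v (m+1)"
  "spin_rep m H_gen *\<^sub>v unit_vec (m+1) 0 = of_nat m \<cdot>\<^sub>v unit_vec (m+1) 0"
proof -
  have c: "unit_vec (m+1) 0 \<in> carrier_vec (m+1)" by simp
  show "spin_rep m E_gen *\<^sub>v unit_vec (m+1) 0 = 0\<^sub>v (m+1)"
    by (rule eq_vecI) (auto simp: spin_rep_E_apply[OF c, unfolded Suc_eq_plus1[symmetric]] dim_spin_rep less_Suc_eq_le simp del: spin_rep.simps index_mult_mat_vec)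
  show "spin_rep m H_gen *\<^sub>v unit_vec (m+1) 0 = of_nat m \<cdot>\<^sub>v unit_vec (m+1) 0"
    by (rule eq_vecI) (auto simp: spin_rep_H_apply[OF c, unfolded Suc_eq_plus1[symmetric]] dim_spin_rep less_Suc_eq_le simp del: spin_rep.simps index_mult_mat_vec)
qed

text \<open>
  The highest weight line of an irreducible representation.
\<close>

lemma spin_kernel_E:
  assumes v: "v \<in> carrier_vec (m+1)" and z: "spin_rep m E_gen *\<^sub>v v = 0\<^sub>v (m+1)"
  shows "v = v $ 0 \<cdot>\<^sub>v unit_vec (m+1) 0"
proof (rule eq_vecI)
  fix i assume "i < dim_vec (v $ 0 \<cdot>\<^sub>v unit_vec (m+1) 0)"
  then have i: "i \<le> m" by simp
  show "v $ i = (v $ 0 \<cdot>\<^sub>v unit_vec (m+1) 0) $ i"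
  proof (cases i)
    case (Suc i')
    have "of_nat (m - i') * v $ i = (spin_rep m E_gen *\<^sub>v v) $ i'"
      using spin_rep_E_apply[OF v, of i'] i Suc by simp
    also have "\<dots> = 0" using z i Suc by simp
    finally show ?thesis using i Suc by (simp add: unit_vec_def)
  qed simp
qed (use v in simp)

lemma projector_carrier: "spin_projector n j P \<Longrightarrow> P \<in> carrier_mat ((n+1)^2) ((n+1)^2)"
  and intertwiner_projector: "spin_projector n j P \<Longrightarrow> intertwiner n (act n P)"
  unfolding spin_projector_def by (auto intro: intertwiner_act)

text \<open>
  The image under \<open>T\<close> of the highest weight vector is a highest weight vector of level \<open>n - j\<close>, hence a
  nonzero multiple of \<open>hw n (n - j)\<close>, and it lies in the range of \<open>P\<close>. For another level \<open>k\<close>, the vector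
  \<open>P (hw n k)\<close> is \<open>T v\<close> with \<open>v\<close> killed by the raising operator, so it lies on the same line, while
  \<open>P\<close> preserves levels; hence it is zero.
\<close>

lemma projector_hw:
  assumes P: "spin_projector n j P" and j: "j \<le> n" and k: "k \<le> n"
  shows "act n P (hw n k) = (\<lambda>a b. if k = n - j then hw n k a b else 0)"
proof -
  let ?N = "(n+1)^2" and ?u = "unit_vec (2*j+1) 0 :: complex vec"
  have Pc: "P \<in> carrier_mat ?N ?N" and PP: "P * P = P" using P by (auto simp: spin_projector_def)
  obtain T where T: "T \<in> carrier_mat ?N (2*j+1)"
    and TE: "\<And>x. tensor_rep n x * T = T * spin_rep (2*j) x"
    and inj: "inj_on (\<lambda>v. T *\<^sub>v v) (carrier_vec (2*j+1))"
    and im: "(\<lambda>v. P *\<^sub>v v) ` carrier_vec ?N = (\<lambda>v. T *\<^sub>v v) ` carrier_vec (2*j+1)"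
    using P unfolding spin_projector_def by blast
  have inj': "v = v'"
    if "T *\<^sub>v v = T *\<^sub>v v'" "v \<in> carrier_vec (2*j+1)" "v' \<in> carrier_vec (2*j+1)" for v v'
    using inj that unfolding inj_on_def by blast
  have Tv: "T *\<^sub>v v \<in> carrier_vec ?N" if "v \<in> carrier_vec (2*j+1)" for v
    using T that by (rule mult_mat_vec_carrier)
  have tc: "tensor_rep n x \<in> carrier_mat ?N ?N" for x
    by (auto simp: tensor_rep_def tensor_mat_def power2_eq_square dim_spin_rep)
  have move: "act n (tensor_rep n x) (entries2 n (T *\<^sub>v v)) = entries2 n (T *\<^sub>v (spin_rep (2*j) x *\<^sub>v v))"
    if v: "v \<in> carrier_vec (2*j+1)" for x v
    by (simp only: act_entries2[OF Tv[OF v]] TE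
        assoc_mult_mat_vec[OF tc T v, symmetric] assoc_mult_mat_vec[OF T spin_rep_carrier v, symmetric])
  define w where "w = entries2 n (T *\<^sub>v ?u)"
  have uc: "?u \<in> carrier_vec (2*j+1)" by simp
  have T0: "T *\<^sub>v 0\<^sub>v (2*j+1) = 0\<^sub>v ?N" by (rule eq_vecI) (use T in auto)
  have "raise n w = (\<lambda>a b. 0)"
    unfolding w_def act_raise[symmetric] move[OF uc] spin_highest_weight T0 by (rule entries2_zero)
  moreover have H: "weigh n w = (\<lambda>a b. of_nat (2*j) * w a b)"
    unfolding w_def act_weigh[symmetric] move[OF uc] spin_highest_weight mult_mat_vec[OF T uc]
    by (rule entries2_smult[OF Tv[OF uc]])
  have "level n (n - j) w"
    unfolding level_def
  proof (intro allI impI)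
    fix a b assume ab: "n < a \<or> n < b \<or> a + b \<noteq> n - j"
    show "w a b = 0"
    proof (cases "a \<le> n \<and> b \<le> n")
      case True
      then have "2 * (of_nat n - of_nat (a + b + j)) * w a b = 0"
        using fun_cong[OF fun_cong[OF H, of a], of b] by (simp add: weigh_def algebra_simps)
      moreover have "n \<noteq> a + b + j" using ab True j by auto
      then have "(of_nat n - of_nat (a + b + j) :: complex) \<noteq> 0"
        unfolding right_minus_eq of_nat_eq_iff .
      ultimately show ?thesis by (simp del: of_nat_add)
    qed (auto simp: w_def entries2_def)
  qed
  ultimately obtain c where c: "w = (\<lambda>a b. c * hw n (n - j) a b)"
    using hw_unique(1)[of n "n - j" w] by auto
  have "c \<noteq> 0"
  proof
    assume "c = 0"
    then have "w = (\<lambda>a b. 0)" using c by simp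
    then have "T *\<^sub>v ?u = coords2 n (\<lambda>a b. 0)" using coords2_entries2[OF Tv[OF uc]] unfolding w_def[symmetric] by simp
    also have "\<dots> = 0\<^sub>v ?N" by (rule eq_vecI) (auto simp: coords2_def)
    also have "\<dots> = T *\<^sub>v 0\<^sub>v (2*j+1)" using T0 by simp
    finally have "?u = 0\<^sub>v (2*j+1)" by (rule inj') simp_all
    then have "?u $ 0 = 0\<^sub>v (2*j+1) $ 0" by simp
    then show False by simp
  qed
  show ?thesis
  proof (cases "k = n - j")
    case True
    have "T *\<^sub>v ?u \<in> (\<lambda>v. P *\<^sub>v v) ` carrier_vec ?N" unfolding im using uc by (rule imageI)
    then obtain x where x: "T *\<^sub>v ?u = P *\<^sub>v x" "x \<in> carrier_vec ?N" by (rule imageE)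
    have "P *\<^sub>v (P *\<^sub>v x) = P *\<^sub>v x" using assoc_mult_mat_vec[OF Pc Pc x(2)] PP by simp
    then have "act n P w = w" using act_entries2[OF Tv[OF uc], of P] by (simp only: w_def x(1))
    then have eq: "(\<lambda>a b. c * act n P (hw n k) a b) = (\<lambda>a b. c * hw n k a b)"
      using intertwiner_scale[OF intertwiner_projector[OF P], of c "hw n k"] by (simp add: c True)
    have "act n P (hw n k) a b = hw n k a b" for a b
      using fun_cong[OF fun_cong[OF eq, of a], of b] \<open>c \<noteq> 0\<close> by simp
    then show ?thesis using True by (intro ext) simp
  next
    case False
    have "P *\<^sub>v coords2 n (hw n k) \<in> (\<lambda>v. T *\<^sub>v v) ` carrier_vec (2*j+1)"
      unfolding im[symmetric] by (rule imageI) (rule coords_carrier)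
    then obtain v where v: "P *\<^sub>v coords2 n (hw n k) = T *\<^sub>v v" "v \<in> carrier_vec (2*j+1)"
      by (rule imageE)
    have y: "act n P (hw n k) = entries2 n (T *\<^sub>v v)" by (simp only: act_eq_entries2 v(1))
    have Ev: "spin_rep (2*j) E_gen *\<^sub>v v \<in> carrier_vec (2*j+1)"
      using spin_rep_carrier v(2) by (rule mult_mat_vec_carrier)
    have "entries2 n (T *\<^sub>v (spin_rep (2*j) E_gen *\<^sub>v v)) = raise n (act n P (hw n k))"
      unfolding y act_raise[symmetric] move[OF v(2)] ..
    also have "\<dots> = (\<lambda>a b. 0)"
      using intertwiner_raise[OF intertwiner_projector[OF P], of "hw n k"]
        intertwiner_zero_arg[OF intertwiner_projector[OF P]] raise_hw[OF k] by simp
    finally have "T *\<^sub>v (spin_rep (2*j) E_gen *\<^sub>v v) = coords2 n (\<lambda>a b. 0)"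
      using coords2_entries2[OF Tv[OF Ev]] by simp
    also have "\<dots> = 0\<^sub>v ?N" by (rule eq_vecI) (auto simp: coords2_def)
    also have "\<dots> = T *\<^sub>v 0\<^sub>v (2*j+1)" using T0 by simp
    finally have "spin_rep (2*j) E_gen *\<^sub>v v = 0\<^sub>v (2*j+1)"
      by (rule inj') (rule Ev, simp)
    then have "v = v $ 0 \<cdot>\<^sub>v ?u" by (rule spin_kernel_E[OF v(2)])
    then obtain s where s: "v = s \<cdot>\<^sub>v ?u" by (rule that)
    have "T *\<^sub>v v = s \<cdot>\<^sub>v (T *\<^sub>v ?u)" unfolding s by (rule mult_mat_vec[OF T uc])
    then have eq: "act n P (hw n k) = (\<lambda>a b. s * (c * hw n (n - j) a b))"
      unfolding y by (simp only: entries2_smult[OF Tv[OF uc]] w_def[symmetric] c)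
    moreover have "level n k (act n P (hw n k))"
      by (rule intertwiner_level[OF intertwiner_projector[OF P] level_hw[OF k]])
    ultimately have "act n P (hw n k) a b = 0" for a b
    proof (cases "a + b = k")
      case True
      then show ?thesis using eq False by (simp add: hw_def)
    qed (simp add: level_def)
    then have "act n P (hw n k) = (\<lambda>a b. 0)" by (intro ext)
    then show ?thesis using False by simp
  qed
qed

text \<open>
  Every basis tensor belongs to a level.
\<close>

lemma mat_eq_by_levels:
  assumes A: "A \<in> carrier_mat ((n+1)^2) ((n+1)^2)" and B: "B \<in> carrier_mat ((n+1)^2) ((n+1)^2)"
    and e: "\<And>l W. level n l W \<Longrightarrow> act n A W = act n B W"
  shows "A = B"
proof (rule eq_matI)
  fix I J assume "I < dim_row B" "J < dim_col B"
  then have IJ: "I < (n+1) * (n+1)" "J < (n+1) * (n+1)" using B by (auto simp: power2_eq_square)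
  have le: "I div (n+1) \<le> n" "I mod (n+1) \<le> n" "J div (n+1) \<le> n" "J mod (n+1) \<le> n"
    using less_mult_imp_div_less[OF IJ(1)] less_mult_imp_div_less[OF IJ(2)]
      mod_less_divisor[of "n+1" I] mod_less_divisor[of "n+1" J] by simp_all
  define W where "W i j = (if i = J div (n+1) \<and> j = J mod (n+1) then 1 else 0 :: complex)" for i j
  have W: "level n (J div (n+1) + J mod (n+1)) W"
    unfolding level_def
  proof (intro allI impI)
    fix i j assume "n < i \<or> n < j \<or> i + j \<noteq> J div (n+1) + J mod (n+1)"
    then have "\<not> (i = J div (n+1) \<and> j = J mod (n+1))" using le by (metis not_le)
    then show "W i j = 0" by (simp only: W_def if_False)
  qed
  have "coords2 n W = unit_vec ((n+1)^2) J"
    using IJ by (intro eq_vecI) (auto simp: coords2_def W_def unit_vec_def power2_eq_square simp del: mult_Suc mult_Suc_right,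
      metis div_mult_mod_eq)
  moreover have "(I div (n+1)) * (n+1) + I mod (n+1) = I" by (rule div_mult_mod_eq)
  ultimately have *: "act n X W (I div (n+1)) (I mod (n+1)) = X $$ (I, J)"
    if "X \<in> carrier_mat ((n+1)^2) ((n+1)^2)" for X
    using that le IJ by (simp add: act_def power2_eq_square del: mult_Suc mult_Suc_right)
  show "A $$ (I, J) = B $$ (I, J)" using *[OF A] *[OF B] e[OF W] by simp
qed (use A B in auto)

lemma act_one: "level n l W \<Longrightarrow> act n (1\<^sub>m ((n+1)^2)) W = W"
proof (intro ext)
  fix i j assume "level n l W"
  then show "act n (1\<^sub>m ((n+1)^2)) W i j = W i j"
    unfolding act_def one_mult_mat_vec[OF coords_carrier(1)]
    using coords2_index[of i n j W] by (auto simp: level_def simp del: mult_Suc mult_Suc_right)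
qed

lemma act_flip_mat:
  assumes "level n l W"
  shows "act n (flip_mat n) W = (\<lambda>i j. W j i)"
proof (intro ext)
  fix i j
  show "act n (flip_mat n) W i j = W j i"
  proof (cases "i \<le> n \<and> j \<le> n")
    case True
    then have p: "i * (n+1) + j < (n+1) * (n+1)" using pair_index[of i "n+1" j "n+1"] by simp
    have "act n (flip_mat n) W i j = (\<Sum>I<(n+1)*(n+1). flip_mat n $$ (i * (n+1) + j, I) * coords2 n W $ I)"
      using True p by (simp add: act_def flip_mat_def scalar_prod_def coords2_def power2_eq_square atLeast0LessThan del: mult_Suc mult_Suc_right)
    also have "\<dots> = (\<Sum>a<n+1. \<Sum>b<n+1. if b = i then (if a = j then W a b else 0) else 0)"
      unfolding sum_pair_index
    proof (intro sum.cong refl)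
      fix a b assume ab: "a \<in> {..<n+1}" "b \<in> {..<n+1}"
      then have "a * (n+1) + b < (n+1) * (n+1)" using pair_index[of a "n+1" b "n+1"] by simp
      moreover have "coords2 n W $ (a * (n+1) + b) = W a b" using ab by (intro coords2_index) auto
      ultimately show "flip_mat n $$ (i * (n+1) + j, a * (n+1) + b) * coords2 n W $ (a * (n+1) + b) =
          (if b = i then (if a = j then W a b else 0) else 0)"
        using True p ab by (simp add: flip_mat_def power2_eq_square del: mult_Suc mult_Suc_right)
    qed
    also have "\<dots> = W j i" using True by (simp add: sum.delta)
    finally show ?thesis .
  qed (use assms in \<open>auto simp: act_def level_def\<close>)
qed

lemma act_add:
  assumes "A \<in> carrier_mat ((n+1)^2) ((n+1)^2)" "B \<in> carrier_mat ((n+1)^2) ((n+1)^2)"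
  shows "act n (A + B) W = (\<lambda>i j. act n A W i j + act n B W i j)"
proof (intro ext)
  fix i j
  have "i * (n+1) + j < (n+1)^2" if "i \<le> n" "j \<le> n"
    using that pair_index[of i "n+1" j "n+1"] by (simp add: power2_eq_square)
  then show "act n (A + B) W i j = act n A W i j + act n B W i j"
    unfolding act_def add_mult_distrib_mat_vec[OF assms coords_carrier(1)]
    using assms by (auto simp del: mult_Suc mult_Suc_right index_mult_mat_vec)
qed

lemma act_smult:
  assumes "A \<in> carrier_mat ((n+1)^2) ((n+1)^2)"
  shows "act n (c \<cdot>\<^sub>m A) W = (\<lambda>i j. c * act n A W i j)"
proof (intro ext)
  fix i j
  have "i * (n+1) + j < (n+1)^2" if "i \<le> n" "j \<le> n"
    using that pair_index[of i "n+1" j "n+1"] by (simp add: power2_eq_square)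
  then show "act n (c \<cdot>\<^sub>m A) W i j = c * act n A W i j"
    using assms by (auto simp: act_def scalar_prod_def sum_distrib_left mult.assoc coords2_def simp del: mult_Suc mult_Suc_right)
qed

lemma lincomb_carrier [simp]: "lincomb_mat n J r P \<in> carrier_mat ((n+1)^2) ((n+1)^2)"
  by (simp add: lincomb_mat_def)

lemma act_lincomb:
  assumes P: "\<And>s. s \<in> J \<Longrightarrow> P s \<in> carrier_mat ((n+1)^2) ((n+1)^2)"
  shows "act n (lincomb_mat n J r P) W = (\<lambda>i j. \<Sum>s\<in>J. r s * act n (P s) W i j)"
proof (intro ext)
  fix i j
  show "act n (lincomb_mat n J r P) W i j = (\<Sum>s\<in>J. r s * act n (P s) W i j)"
  proof (cases "i \<le> n \<and> j \<le> n")
    case True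
    let ?I = "i * (n+1) + j" and ?N = "(n+1)^2"
    have p: "?I < ?N" using True pair_index[of i "n+1" j "n+1"] by (simp add: power2_eq_square)
    have a: "act n X W i j = (\<Sum>b<?N. X $$ (?I, b) * coords2 n W $ b)"
      if "X \<in> carrier_mat ?N ?N" for X
      using that True p by (simp add: act_def scalar_prod_def coords2_def atLeast0LessThan del: mult_Suc mult_Suc_right)
    have "act n (lincomb_mat n J r P) W i j = (\<Sum>b<?N. (\<Sum>s\<in>J. r s * P s $$ (?I, b)) * coords2 n W $ b)"
      unfolding a[OF lincomb_carrier] by (rule sum.cong) (use p in \<open>auto simp: lincomb_mat_def\<close>)
    also have "\<dots> = (\<Sum>s\<in>J. r s * (\<Sum>b<?N. P s $$ (?I, b) * coords2 n W $ b))"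
      unfolding sum_distrib_right sum_distrib_left by (subst sum.swap) (simp add: mult.assoc)
    also have "\<dots> = (\<Sum>s\<in>J. r s * act n (P s) W i j)"
      by (rule sum.cong) (use P a in auto)
    finally show ?thesis .
  qed (auto simp: act_def)
qed

lemma lincomb_projectors:
  assumes P: "\<And>s. s \<le> n \<Longrightarrow> spin_projector n s (P s)" and J: "J \<subseteq> {..n}"
  shows "intertwiner n (act n (lincomb_mat n J r P))"
    and "k \<le> n \<Longrightarrow> act n (lincomb_mat n J r P) (hw n k) =
      (\<lambda>i j. (if n - k \<in> J then r (n - k) else 0) * hw n k i j)"
proof -
  have fin: "finite J" using J finite_subset by blast
  have c: "P s \<in> carrier_mat ((n+1)^2) ((n+1)^2)" if "s \<in> J" for s
    using that J P[THEN projector_carrier] by auto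
  have "act n (lincomb_mat n J r P) = (\<lambda>W i j. \<Sum>s\<in>J. r s * act n (P s) W i j)"
    by (rule ext) (rule act_lincomb[OF c])
  moreover have "intertwiner n (\<lambda>W i j. \<Sum>s\<in>J. r s * act n (P s) W i j)"
    by (rule intertwiner_sum[OF fin]) (use J P[THEN intertwiner_projector] in auto)
  ultimately show "intertwiner n (act n (lincomb_mat n J r P))" by simp
  assume k: "k \<le> n"
  show "act n (lincomb_mat n J r P) (hw n k) = (\<lambda>i j. (if n - k \<in> J then r (n - k) else 0) * hw n k i j)"
  proof (intro ext)
    fix i j
    have "act n (lincomb_mat n J r P) (hw n k) i j = (\<Sum>s\<in>J. r s * act n (P s) (hw n k) i j)"
      by (simp only: act_lincomb[OF c])
    also have "\<dots> = (\<Sum>s\<in>J. if s = n - k then r s * hw n k i j else 0)"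
    proof (rule sum.cong)
      fix s assume "s \<in> J"
      then have s: "s \<le> n" using J by auto
      then have "k = n - s \<longleftrightarrow> s = n - k" using k by auto
      then show "r s * act n (P s) (hw n k) i j = (if s = n - k then r s * hw n k i j else 0)"
        using projector_hw[OF P[OF s] s k] by simp
    qed simp
    also have "\<dots> = (if n - k \<in> J then r (n - k) else 0) * hw n k i j"
      using fin by (simp add: sum.delta)
    finally show "act n (lincomb_mat n J r P) (hw n k) i j = (if n - k \<in> J then r (n - k) else 0) * hw n k i j" .
  qed
qed

section \<open>The braid relation on three factors\<close>

definition level3 :: "nat \<Rightarrow> nat \<Rightarrow> (nat \<Rightarrow> nat \<Rightarrow> nat \<Rightarrow> complex) \<Rightarrow> bool" where
  "level3 n k T \<longleftrightarrow> (\<forall>i j l. n < i \<or> n < j \<or> n < l \<or> i + j + l \<noteq> k \<longrightarrow> T i j l = 0)"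

definition rev3 :: "(nat \<Rightarrow> nat \<Rightarrow> nat \<Rightarrow> complex) \<Rightarrow> nat \<Rightarrow> nat \<Rightarrow> nat \<Rightarrow> complex" where
  "rev3 T = (\<lambda>i j l. T l j i)"

text \<open>
  Up to one common scalar, \<open>hw12\<close>, \<open>hw23\<close>, \<open>hw13\<close> are the polynomials \<open>(x - y)\<^bsup>k\<^esup>\<close>, \<open>(y - z)\<^bsup>k\<^esup>\<close>, \<open>(x - z)\<^bsup>k\<^esup>\<close>,
  highest weight vectors on three factors.
\<close>

definition hw12 :: "nat \<Rightarrow> nat \<Rightarrow> nat \<Rightarrow> nat \<Rightarrow> nat \<Rightarrow> complex" where
  "hw12 n k i j l = (if l = 0 then hw n k i j else 0)"

definition hw23 :: "nat \<Rightarrow> nat \<Rightarrow> nat \<Rightarrow> nat \<Rightarrow> nat \<Rightarrow> complex" where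
  "hw23 n k i j l = (if i = 0 then hw n k j l else 0)"

definition hw13 :: "nat \<Rightarrow> nat \<Rightarrow> nat \<Rightarrow> nat \<Rightarrow> nat \<Rightarrow> complex" where
  "hw13 n k i j l = (if j = 0 then hw n k i l else 0)"

lemma sign_square: "(-1) ^ k * (-1) ^ k = (1 :: complex)"
  by (simp flip: power_mult_distrib)

lemma hw_swap: "hw n k j i = (-1) ^ k * hw n k i j"
proof (cases "i + j = k")
  case True
  have *: "(-1) ^ k * (-1) ^ j = ((-1) ^ i :: complex)"
    using sign_square[of j] by (simp add: True[symmetric] power_add mult.assoc)
  have "hw n k j i = (-1) ^ i * fact (n - i) * fact (n - j)" using True by (simp add: hw_def add.commute)
  also have "\<dots> = (-1) ^ k * hw n k i j" using True by (simp add: hw_def mult.assoc flip: *)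
  finally show ?thesis .
qed (simp add: hw_def add.commute)

lemma hw_flip: "(\<lambda>i j. hw n k j i) = (\<lambda>i j. (-1) ^ k * hw n k i j)"
  by (intro ext) (rule hw_swap)

lemma slice12_level: "level3 n k T \<Longrightarrow> level n (k - l) (\<lambda>i j. T i j l)"
  and slice23_level: "level3 n k T \<Longrightarrow> level n (k - i) (T i)"
  by (auto simp: level_def level3_def)

lemma level3_hw:
  assumes "k \<le> n"
  shows "level3 n k (hw12 n k)" "level3 n k (hw23 n k)" "level3 n k (hw13 n k)"
  using assms by (auto simp: level3_def hw12_def hw23_def hw13_def hw_def)

lemma rev3_hw:
  "rev3 (hw12 n k) = (\<lambda>i j l. (-1) ^ k * hw23 n k i j l)"
  "rev3 (hw23 n k) = (\<lambda>i j l. (-1) ^ k * hw12 n k i j l)"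
  "rev3 (hw13 n k) = (\<lambda>i j l. (-1) ^ k * hw13 n k i j l)"
  unfolding rev3_def hw12_def hw23_def hw13_def by (intro ext; simp add: hw_swap[symmetric])+

lemma on12_linear:
  assumes "intertwiner n \<Phi>"
  shows "on12 \<Phi> (\<lambda>i j l. a * T i j l + b * S i j l) = (\<lambda>i j l. a * on12 \<Phi> T i j l + b * on12 \<Phi> S i j l)"
  by (simp add: on12_def intertwiner_linear[OF assms])

lemma on23_linear:
  assumes "intertwiner n \<Phi>"
  shows "on23 \<Phi> (\<lambda>i j l. a * T i j l + b * S i j l) = (\<lambda>i j l. a * on23 \<Phi> T i j l + b * on23 \<Phi> S i j l)"
  by (simp add: on23_def intertwiner_linear[OF assms])

lemma on12_scale: "intertwiner n \<Phi> \<Longrightarrow> on12 \<Phi> (\<lambda>i j l. a * T i j l) = (\<lambda>i j l. a * on12 \<Phi> T i j l)"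
  using on12_linear[of n \<Phi> a T 0 T] by simp

lemma on23_scale: "intertwiner n \<Phi> \<Longrightarrow> on23 \<Phi> (\<lambda>i j l. a * T i j l) = (\<lambda>i j l. a * on23 \<Phi> T i j l)"
  using on23_linear[of n \<Phi> a T 0 T] by simp

text \<open>
  A slice at \<open>z = 0\<close> is \<open>(x - y)\<^bsup>k\<^esup>\<close>, \<open>y\<^bsup>k\<^esup>\<close> or \<open>x\<^bsup>k\<^esup>\<close>. The last two have a single coordinate, so only one term of
  the functional survives.
\<close>

lemma hw_coeff_slices:
  assumes "k \<le> n"
  shows "hw_coeff n k (\<lambda>i j. hw12 n k i j 0) = 1"
    and "hw_coeff n k (\<lambda>i j. hw23 n k i j 0) = (-1) ^ k * eta n k"
    and "hw_coeff n k (\<lambda>i j. hw13 n k i j 0) = eta n k"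
proof -
  show "hw_coeff n k (\<lambda>i j. hw12 n k i j 0) = 1"
    using hw_coeff_hw[OF assms] by (simp add: hw12_def)
  have "(\<Sum>i\<le>k. (-1) ^ (k - i) * of_nat (k choose i) * hw23 n k i (k - i) 0) =
      (\<Sum>i\<le>k. if i = 0 then (-1) ^ k * (fact n * fact (n - k)) else 0 :: complex)"
    by (rule sum.cong) (auto simp: hw23_def hw_def)
  then show "hw_coeff n k (\<lambda>i j. hw23 n k i j 0) = (-1) ^ k * eta n k"
    unfolding hw_coeff_def eta_hw_norm[OF assms] by (simp add: sum.delta)
  have "(\<Sum>i\<le>k. (-1) ^ (k - i) * of_nat (k choose i) * hw13 n k i (k - i) 0) =
      (\<Sum>i\<le>k. if i = k then fact n * fact (n - k) else 0 :: complex)"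
    by (rule sum.cong) (auto simp: hw13_def hw_def)
  then show "hw_coeff n k (\<lambda>i j. hw13 n k i j 0) = eta n k"
    unfolding hw_coeff_def eta_hw_norm[OF assms] by (simp add: sum.delta)
qed

text \<open>
  Slices with positive third index have level below \<open>k\<close> and are killed; only the slice with third index
  \<open>0\<close> contributes.
\<close>

lemma on12_at:
  assumes \<Phi>: "intertwiner n \<Phi>" and z: "\<And>j. j < k \<Longrightarrow> \<Phi> (hw n j) = (\<lambda>i j. 0)"
    and k: "k \<le> n" and g: "\<Phi> (hw n k) = (\<lambda>i j. g * hw n k i j)" and T: "level3 n k T"
  shows "on12 \<Phi> T = (\<lambda>i j l. g * hw_coeff n k (\<lambda>a b. T a b 0) * hw12 n k i j l)"
proof (intro ext)
  fix i j l
  show "on12 \<Phi> T i j l = g * hw_coeff n k (\<lambda>a b. T a b 0) * hw12 n k i j l"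
  proof (cases "l = 0")
    case True
    have "\<Phi> (\<lambda>a b. T a b 0) = (\<lambda>i j. hw_coeff n k (\<lambda>a b. T a b 0) * \<Phi> (hw n k) i j)"
      by (rule intertwiner_at[OF \<Phi> z k]) (use slice12_level[OF T, of 0] in simp_all)
    then show ?thesis using True by (simp add: on12_def hw12_def g)
  next
    case False
    have "\<Phi> (\<lambda>a b. T a b l) = (\<lambda>i j. 0)"
    proof (cases "l \<le> k")
      case True
      then show ?thesis
        by (intro intertwiner_below[OF \<Phi> z, of k "k - l"] slice12_level[OF T]) (use False k in simp_all)
    next
      case False
      then have "(\<lambda>a b. T a b l) = (\<lambda>a b. 0)" using T by (intro ext) (simp add: level3_def)
      then show ?thesis using intertwiner_zero_arg[OF \<Phi>] by simp
    qed
    then show ?thesis using False by (simp add: on12_def hw12_def)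
  qed
qed

text \<open>
  An equivariant solution of the braid relation with eigenvalue \<open>\<rho> k\<close> on the component of spin
  \<open>n - k\<close>.
\<close>

locale sl2_braiding =
  fixes n :: nat and \<Phi> :: "(nat \<Rightarrow> nat \<Rightarrow> complex) \<Rightarrow> nat \<Rightarrow> nat \<Rightarrow> complex" and \<rho> :: "nat \<Rightarrow> complex"
  assumes inter: "intertwiner n \<Phi>"
    and eigen: "\<And>k. k \<le> n \<Longrightarrow> \<Phi> (hw n k) = (\<lambda>i j. \<rho> k * hw n k i j)"
    and braid: "\<And>T i j l. i \<le> n \<Longrightarrow> j \<le> n \<Longrightarrow> l \<le> n \<Longrightarrow>
      on12 \<Phi> (on23 \<Phi> (on12 \<Phi> T)) i j l = on23 \<Phi> (on12 \<Phi> (on23 \<Phi> T)) i j l"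
begin

text \<open>
  Both composites act on \<open>hw n k\<close> by \<open>(-1)\<^bsup>k\<^esup> \<rho> k\<close>.
\<close>

lemma flip_commute:
  assumes "level n l W"
  shows "\<Phi> (\<lambda>i j. W j i) = (\<lambda>i j. \<Phi> W j i)"
proof -
  let ?\<Psi> = "\<lambda>W i j. \<Phi> (\<lambda>i j. W j i) i j - \<Phi> W j i"
  have "intertwiner n ?\<Psi>"
    by (rule intertwiner_diff intertwiner_compose[OF inter intertwiner_flip]
        intertwiner_compose[OF intertwiner_flip inter])+
  moreover have "?\<Psi> (hw n k) = (\<lambda>i j. 0)" if "k \<le> n" for k
  proof -
    have 1: "\<Phi> (\<lambda>i j. hw n k j i) = (\<lambda>i j. (-1) ^ k * (\<rho> k * hw n k i j))"
      unfolding hw_flip intertwiner_scale[OF inter] eigen[OF that] ..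
    show ?thesis
    proof (intro ext)
      fix i j
      show "?\<Psi> (hw n k) i j = 0"
        unfolding 1 eigen[OF that] using hw_swap[of n k j i] by simp
    qed
  qed
  ultimately have "?\<Psi> W = (\<lambda>i j. 0)" using assms by (rule intertwiner_eq_zero)
  then have "?\<Psi> W i j = 0" for i j by metis
  then show ?thesis by (intro ext) simp
qed

text \<open>
  Reversing the factors exchanges the two actions, so every formula for \<open>on12\<close> has a mirror image for
  \<open>on23\<close>.
\<close>

lemma on23_rev3:
  assumes "level3 n k T"
  shows "on23 \<Phi> T = rev3 (on12 \<Phi> (rev3 T))"
  unfolding on23_def on12_def rev3_def using flip_commute[OF slice23_level[OF assms]] by (intro ext) simp

text \<open>
  On the span of \<open>e\<close> and its mirror image \<open>f\<close> the two operators are triangular \<open>2 \<times> 2\<close> matrices. Applied to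
  \<open>e\<close>, the two sides of the braid relation differ in the coefficient of \<open>f\<close> by \<open>a (a\<^sup>2 + p)\<close>, which is read
  off at a point where \<open>e\<close> vanishes and \<open>f\<close> does not.
\<close>

lemma braid_pair:
  assumes lev: "level3 n k e" "level3 n k f"
    and e: "on12 \<Phi> e = (\<lambda>i j l. p * e i j l)" and f: "on12 \<Phi> f = (\<lambda>i j l. f i j l + a * e i j l)"
    and r: "rev3 e = (\<lambda>i j l. s * f i j l)" "rev3 f = (\<lambda>i j l. s * e i j l)" and s: "s * s = 1"
    and x: "i \<le> n" "j \<le> n" "l \<le> n" "e i j l = 0" "f i j l \<noteq> 0" and a: "a \<noteq> 0"
  shows "a\<^sup>2 + p = 0"
proof -
  have r': "e l j i = s * f i j l" "f l j i = s * e i j l" for i j l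
    using fun_cong[OF fun_cong[OF fun_cong[OF r(1), of i], of j], of l]
      fun_cong[OF fun_cong[OF fun_cong[OF r(2), of i], of j], of l] by (simp_all add: rev3_def)
  have ss: "s * (s * c) = c" for c using s by (simp add: mult.assoc[symmetric])
  have f23: "on23 \<Phi> f = (\<lambda>i j l. p * f i j l)"
  proof (intro ext)
    fix i j l show "on23 \<Phi> f i j l = p * f i j l"
      unfolding on23_rev3[OF lev(2)] r on12_scale[OF inter] e unfolding rev3_def r'(1)[of l j i]
      using ss[of "p * f i j l"] by (simp only: mult.left_commute)
  qed
  have e23: "on23 \<Phi> e = (\<lambda>i j l. 1 * e i j l + a * f i j l)"
  proof (intro ext)
    fix i j l show "on23 \<Phi> e i j l = 1 * e i j l + a * f i j l"
      unfolding on23_rev3[OF lev(1)] r on12_scale[OF inter] f unfolding rev3_def r'[of l j i]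
      using ss[of "e i j l"] ss[of "a * f i j l"] by (simp only: distrib_left mult.left_commute mult_1)
  qed
  have f12: "on12 \<Phi> f = (\<lambda>i j l. 1 * f i j l + a * e i j l)" using f by simp
  have "on12 \<Phi> (on23 \<Phi> (on12 \<Phi> e)) i j l = p * (a * f i j l)"
    unfolding e on23_scale[OF inter] e23 on12_scale[OF inter] on12_linear[OF inter] f12 using x by simp
  moreover have "on23 \<Phi> (on12 \<Phi> (on23 \<Phi> e)) i j l = (p + a\<^sup>2) * (a * f i j l) + a * (p * f i j l)"
    unfolding e23 on12_linear[OF inter] e f12 on23_linear[OF inter] on23_scale[OF inter] f23
    using x by (simp add: algebra_simps power2_eq_square)
  ultimately have "(a * f i j l) * (a\<^sup>2 + p) = 0"
    using braid[OF x(1-3), of e] by (simp add: algebra_simps)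
  then show ?thesis using a x by simp
qed

text \<open>
  The case \<open>e = (x - y)\<^bsup>m\<^esup>\<close>, \<open>f = (y - z)\<^bsup>m\<^esup>\<close> of \<open>braid_pair\<close>: there \<open>p = 1 + g\<close> and \<open>a = \<plusminus> g \<eta>\<^sub>m\<^sub>m\<close> with
  \<open>g = \<rho> m - 1\<close>.
\<close>

lemma first_deviation:
  assumes m: "0 < m" "m \<le> n" and one: "\<And>j. j < m \<Longrightarrow> \<rho> j = 1" and ne: "\<rho> m \<noteq> 1"
  shows "1 + (\<rho> m - 1) + (eta n m)\<^sup>2 * (\<rho> m - 1)\<^sup>2 = 0"
proof -
  let ?X = "\<lambda>W i j. \<Phi> W i j - W i j" and ?g = "\<rho> m - 1"
  have X: "intertwiner n ?X" by (rule intertwiner_diff[OF inter intertwiner_id])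
  have z: "?X (hw n j) = (\<lambda>i j. 0)" if "j < m" for j using eigen[of j] one[OF that] that m by simp
  have g: "?X (hw n m) = (\<lambda>i j. ?g * hw n m i j)" using eigen[OF m(2)] by (simp add: algebra_simps)
  define a where "a = ?g * ((-1) ^ m * eta n m)"
  have on12: "on12 \<Phi> T = (\<lambda>i j l. T i j l + ?g * hw_coeff n m (\<lambda>a b. T a b 0) * hw12 n m i j l)"
    if "level3 n m T" for T
  proof (intro ext)
    fix i j l
    have "on12 ?X T i j l = ?g * hw_coeff n m (\<lambda>a b. T a b 0) * hw12 n m i j l"
      using on12_at[OF X z m(2) g that] by simp
    then show "on12 \<Phi> T i j l = T i j l + ?g * hw_coeff n m (\<lambda>a b. T a b 0) * hw12 n m i j l"
      by (simp add: on12_def algebra_simps)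
  qed
  have e: "on12 \<Phi> (hw12 n m) = (\<lambda>i j l. \<rho> m * hw12 n m i j l)"
    unfolding on12[OF level3_hw(1)[OF m(2)]] hw_coeff_slices[OF m(2)] by (simp add: algebra_simps)
  have f: "on12 \<Phi> (hw23 n m) = (\<lambda>i j l. hw23 n m i j l + a * hw12 n m i j l)"
    unfolding on12[OF level3_hw(2)[OF m(2)]] hw_coeff_slices[OF m(2)] by (simp add: a_def)
  have "a\<^sup>2 + \<rho> m = 0"
  proof (rule braid_pair[OF level3_hw(1,2)[OF m(2)] e f rev3_hw(1,2) sign_square])
    show "hw12 n m 0 0 m = 0" using m by (simp add: hw12_def)
    show "hw23 n m 0 0 m \<noteq> 0" by (simp add: hw23_def hw_def)
    show "a \<noteq> 0" using ne eta_nonzero by (simp add: a_def)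
  qed (use m in auto)
  moreover have "a\<^sup>2 = (eta n m)\<^sup>2 * ?g\<^sup>2"
    using sign_square[of m] by (simp add: a_def power_mult_distrib flip: power_mult power2_eq_square)
  ultimately show ?thesis by (simp add: add.commute)
qed

text \<open>
  If level \<open>m + 1\<close> does not deviate either, \<open>braid_pair\<close> applies to
  \<open>e = (x - y)\<^bsup>m\<^esup> (x + y - 2z)\<close>, the highest weight vector of level \<open>m + 1\<close> inside (spin \<open>n - m\<close>) \<open>\<otimes> V\<close>. It
  yields \<open>a\<^sup>2 + \<rho> m = 0\<close> for \<open>a = g \<eta>\<^sub>m\<^sub>m A / (2n)\<close> with an integer \<open>A > 2n\<close>. Since \<open>first_deviation\<close> gives
  the same with \<open>A / (2n)\<close> replaced by \<open>1\<close>, this is impossible.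
\<close>

lemma second_deviation:
  assumes m: "2 \<le> m" "m < n" and one: "\<And>j. j < m \<Longrightarrow> \<rho> j = 1" and ne: "\<rho> m \<noteq> 1"
  shows "\<rho> (Suc m) \<noteq> 1"
proof
  assume one': "\<rho> (Suc m) = 1"
  let ?X = "\<lambda>W i j. \<Phi> W i j - W i j" and ?g = "\<rho> m - 1"
  have le: "m \<le> n" "Suc m \<le> n" using m by auto
  have X: "intertwiner n ?X" by (rule intertwiner_diff[OF inter intertwiner_id])
  have z: "?X (hw n j) = (\<lambda>i j. 0)" if "j < m" for j using eigen[of j] one[OF that] that m by simp
  have g: "?X (hw n m) = (\<lambda>i j. ?g * hw n m i j)" using eigen[OF le(1)] by (simp add: algebra_simps)
  have z': "?X (hw n (Suc m)) = (\<lambda>i j. 0)" using eigen[OF le(2)] one' by simp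
  have n0: "of_nat n \<noteq> (0::complex)" and nm0: "of_nat (n - m) \<noteq> (0::complex)" using m by auto
  (* (x - y)^m (x + y), up to a scalar: lower sends (x - y)^m to
     (n - m) (x + y) (x - y)^m, and the factor n - m is dropped. *)
  define G where "G = (\<lambda>i j. lower n (hw n m) i j / of_nat (n - m))"
  have G_lower: "lower n (hw n m) = (\<lambda>i j. of_nat (n - m) * G i j)" using nm0 by (simp add: G_def)
  have G_level: "level n (Suc m) G"
    using m unfolding level_def by (auto simp: G_def lower_def hw_def)
  have G_raise: "of_nat (n - i) * G (Suc i) j + of_nat (n - j) * G i (Suc j) = 2 * hw n m i j"
    if "i \<le> n" "j \<le> n" for i j
  proof -
    have "raise n (lower n (hw n m)) i j = of_nat (n - m) * (of_nat (n - i) * G (Suc i) j + of_nat (n - j) * G i (Suc j))"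
      unfolding G_lower using that by (simp add: raise_def algebra_simps)
    moreover have "raise n (lower n (hw n m)) i j = of_nat (n - m) * (2 * hw n m i j)"
      unfolding raise_lower_hw[OF le(1)] by simp
    ultimately show ?thesis using nm0 by (metis mult_left_cancel)
  qed
  have hw_raise: "of_nat (n - i) * hw n m (Suc i) j + of_nat (n - j) * hw n m i (Suc j) = 0"
    if "i \<le> n" "j \<le> n" for i j
    using fun_cong[OF fun_cong[OF raise_hw[OF le(1)], of i], of j] that by (simp add: raise_def)
  have \<Phi>G: "\<Phi> G = (\<lambda>i j. \<rho> m * G i j)"
  proof -
    have "\<Phi> (lower n (hw n m)) = (\<lambda>i j. \<rho> m * lower n (hw n m) i j)"
      using intertwiner_lower[OF inter, of "hw n m"] eigen[OF le(1)]
        lower_linear[of n "\<rho> m" "hw n m" 0 "hw n m"] by simp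
    then show ?thesis
      using intertwiner_scale[OF inter, of "1 / of_nat (n - m)" "lower n (hw n m)"] by (simp add: G_def)
  qed
  (* The factor -2/n belongs to -2z: the raising operator sends the basis vector 1
     of the third factor to n times the basis vector 0, and G to 2 (x - y)^m. *)
  define e where "e = (\<lambda>i j l :: nat. if l = 0 then G i j else if l = 1 then - (2 / of_nat n) * hw n m i j else 0)"
  define f where "f = (\<lambda>i j l. e l j i)"
  have lev: "level3 n (Suc m) e" "level3 n (Suc m) f"
    using G_level level_hw[OF le(1)] m by (auto simp: level3_def level_def e_def f_def)
  have e12: "on12 \<Phi> e = (\<lambda>i j l. \<rho> m * e i j l)"
    unfolding on12_def
  proof (intro ext)
    fix i j l :: nat
    consider "l = 0" | "l = 1" | "l \<noteq> 0" "l \<noteq> 1" by blast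
    then show "\<Phi> (\<lambda>a b. e a b l) i j = \<rho> m * e i j l"
    proof cases
      case 2
      then show ?thesis
        using intertwiner_scale[OF inter, of "- (2 / of_nat n)" "hw n m"] by (simp add: e_def eigen[OF le(1)])
    qed (simp_all add: e_def \<Phi>G intertwiner_zero_arg[OF inter])
  qed
  (* The slices of f with third index 0 and 1. Since f is a highest weight vector, raising
     the first slice in the first two factors gives -n times the second one. *)
  define w0 where "w0 = (\<lambda>a b. f a b 0)"
  define w1 where "w1 = (\<lambda>a b. f a b 1)"
  define b where "b = - (of_nat n / 2) * hw_coeff n m w1"
  have w_level: "level n (Suc m) w0" "level n m w1"
    using slice12_level[OF lev(2), of 0] slice12_level[OF lev(2), of 1] by (simp_all add: w0_def w1_def)
  have w_raise: "raise n w0 = (\<lambda>i j. - of_nat n * w1 i j)"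
  proof (intro ext)
    fix i j
    show "raise n w0 i j = - of_nat n * w1 i j"
    proof (cases "i \<le> n \<and> j \<le> n")
      case True
      then have r: "raise n w0 i j = of_nat (n - i) * e 0 j (Suc i) + of_nat (n - j) * e 0 (Suc j) i"
        by (simp add: raise_def w0_def f_def)
      consider "i = 0" | "i = 1" | "2 \<le> i" by linarith
      then show ?thesis
      proof cases
        case 1
        then show ?thesis unfolding r using G_raise[of 0 j] True n0 by (simp add: e_def w1_def f_def algebra_simps)
      next
        case 2
        have "of_nat (n - j) * hw n m 0 (Suc j) = - of_nat n * hw n m 1 j"
          using hw_raise[of 0 j] True by (simp add: eq_neg_iff_add_eq_0 add.commute)
        then show ?thesis unfolding r using n0 2
          by (simp add: e_def w1_def f_def mult.left_commute[of "of_nat (n - j)" 2])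
      qed (simp_all add: r e_def w1_def f_def)
    next
      case False
      then show ?thesis using w_level(2) by (auto simp: raise_def level_def)
    qed
  qed
  have coeff_raise: "hw_coeff n m (raise n w0) = - of_nat n * hw_coeff n m w1"
    using hw_coeff_linear[of n m "- of_nat n" w1 0 w1] by (simp add: w_raise)
  have X0: "?X w0 i j = ?g * b * G i j" for i j
    using fun_cong[OF fun_cong[OF intertwiner_next[OF X z m(2) g z' w_level(1)], of i], of j] nm0
    by (simp add: coeff_raise G_lower b_def)
  have X1: "?X w1 i j = ?g * b * (- (2 / of_nat n) * hw n m i j)" for i j
    using fun_cong[OF fun_cong[OF intertwiner_at[OF X z le(1) w_level(2)], of i], of j]
      fun_cong[OF fun_cong[OF g, of i], of j] n0
    by (simp add: b_def)
  have f12: "on12 \<Phi> f = (\<lambda>i j l. f i j l + ?g * b * e i j l)"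
  proof (intro ext)
    fix i j l :: nat
    consider "l = 0" | "l = 1" | "2 \<le> l" "l \<le> Suc m" | "Suc m < l" by linarith
    then have "?X (\<lambda>a b. f a b l) i j = ?g * b * e i j l"
    proof cases
      case 1
      then show ?thesis using X0[of i j] by (simp add: w0_def e_def)
    next
      case 2
      then show ?thesis using X1[of i j] by (simp add: w1_def e_def)
    next
      case 3
      have "?X (\<lambda>a b. f a b l) = (\<lambda>i j. 0)"
        by (intro intertwiner_below[OF X z, of m "Suc m - l"] slice12_level[OF lev(2)]) (use 3 m in simp_all)
      then have "?X (\<lambda>a b. f a b l) i j = 0" by (rule fun_cong[OF fun_cong])
      then show ?thesis using 3 by (simp add: e_def)
    next
      case 4
      then have "f a b l = 0" for a b using lev(2) by (simp add: level3_def)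
      then have "?X (\<lambda>a b. f a b l) i j = 0" by (simp add: intertwiner_zero_arg[OF inter])
      then show ?thesis using 4 m by (simp add: e_def)
    qed
    then show "on12 \<Phi> f i j l = f i j l + ?g * b * e i j l" by (simp add: on12_def algebra_simps)
  qed
  (* R acts on f by adding (rho m - 1) b e, and b turns out to be A / (2 n) times eta n m. *)
  define A where "A = n * (m - 1) + 2 * m * (n - m + 1)"
  have A: "2 * n < A"
  proof -
    obtain p where p: "m = p + 2" using m by (metis le_add_diff_inverse2)
    obtain q where "n = m + 1 + q" using m by (metis Suc_eq_plus1 less_iff_Suc_add add_Suc_shift add.assoc plus_1_eq_Suc add.commute)
    then show ?thesis by (simp add: A_def p algebra_simps)
  qed
  have b: "b * of_nat (2 * n) = eta n m * of_nat A"
  proof -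
    define h where "h = hw n m 0 m"
    have m1: "m = Suc (m - 1)" using m by simp
    have h1: "hw n m 1 (m - 1) = - of_nat (n - m + 1) * h / of_nat n"
    proof -
      have "n - (m - 1) = n - m + 1" using m by simp
      then have "of_nat n * hw n m 1 (m - 1) + of_nat (n - m + 1) * h = 0"
        using hw_raise[of 0 "m - 1"] m m1 by (simp add: h_def)
      then show ?thesis using n0 by (simp add: field_simps eq_neg_iff_add_eq_0)
    qed
    have "of_nat (n - m) * G 1 m = h + of_nat m * hw n m 1 (m - 1)"
      using nm0 m by (simp add: G_def lower_def h_def)
    then have "of_nat (n - m) * (of_nat n * G 1 m) = of_nat (n - m) * ((1 - of_nat m) * h)"
      unfolding h1 using n0 m by (simp add: field_simps of_nat_diff)
    then have G1: "G 1 m = (1 - of_nat m) * h / of_nat n" using nm0 n0 by (simp add: eq_divide_eq mult.commute)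
    define t where "t i = (-1) ^ (m - i) * of_nat (m choose i) * w1 i (m - i)" for i
    have "(\<Sum>i\<le>m. t i) = (\<Sum>i\<in>{0, 1}. t i)"
      by (rule sum.mono_neutral_right) (use m in \<open>auto simp: t_def w1_def f_def e_def\<close>)
    also have "\<dots> = (-1) ^ m * G 1 m + (-1) ^ (m - 1) * of_nat m * (- (2 / of_nat n) * hw n m 1 (m - 1))"
      by (simp add: t_def w1_def f_def e_def)
    also have "(-1) ^ (m - 1) = (- ((-1) ^ m) :: complex)" by (subst (2) m1) simp
    also have "(-1) ^ m * G 1 m + - ((-1) ^ m) * of_nat m * (- (2 / of_nat n) * hw n m 1 (m - 1)) =
        - ((-1) ^ m * h) * of_nat A / of_nat n ^ 2"
      unfolding h1 G1 A_def using n0 m by (simp add: field_simps power2_eq_square of_nat_diff)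
    also have "(-1) ^ m * h = fact n * fact (n - m)"
      using sign_square[of m] by (simp add: h_def hw_def)
    finally have "hw_coeff n m w1 = - eta n m * of_nat A / of_nat n ^ 2"
      unfolding hw_coeff_def t_def eta_hw_norm[OF le(1)] by simp
    then show ?thesis using n0 by (simp add: b_def field_simps power2_eq_square)
  qed
  have level_next: "(?g * b)\<^sup>2 + \<rho> m = 0"
  proof (rule braid_pair[OF lev e12 f12, of 1 0 0 "Suc m"])
    show "f 0 0 (Suc m) \<noteq> 0"
      using m by (simp add: f_def e_def G_def lower_def hw_def del: of_nat_Suc)
    show "?g * b \<noteq> 0"
      using ne b eta_nonzero[of n m] A by auto
  qed (use m in \<open>auto simp: e_def f_def rev3_def\<close>)
  have level_m: "1 + ?g + (eta n m)\<^sup>2 * ?g\<^sup>2 = 0"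
    using first_deviation[OF _ le(1) one ne] m by simp
  (* Subtract the quadratic equation of level m from that of level m + 1. *)
  have "?g\<^sup>2 * (b\<^sup>2 - (eta n m)\<^sup>2) = ((?g * b)\<^sup>2 + \<rho> m) - (1 + ?g + (eta n m)\<^sup>2 * ?g\<^sup>2)"
    unfolding power_mult_distrib right_diff_distrib[of "?g\<^sup>2"] by simp
  also have "\<dots> = 0" unfolding level_next level_m by simp
  finally have "b\<^sup>2 = (eta n m)\<^sup>2" using ne by simp
  then have "(eta n m)\<^sup>2 * of_nat ((2 * n)\<^sup>2) = (eta n m)\<^sup>2 * (of_nat (A\<^sup>2) :: complex)"
    using arg_cong[OF b, of "\<lambda>x. x\<^sup>2"] by (simp add: power_mult_distrib)
  then have "(of_nat ((2 * n)\<^sup>2) :: complex) = of_nat (A\<^sup>2)" using eta_nonzero by simp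
  then have "(2 * n)\<^sup>2 = A\<^sup>2" by (simp only: of_nat_eq_iff)
  then have "2 * n = A" by (rule power2_eq_imp_eq) simp_all
  then show False using A by simp
qed

text \<open>
  Subtracting the flip leaves an operator of rank one on level \<open>k\<close>, while the flip itself permutes
  \<open>e = (x - y)\<^bsup>k\<^esup>\<close>, \<open>f = (y - z)\<^bsup>k\<^esup>\<close>, \<open>h = (x - z)\<^bsup>k\<^esup>\<close> up to sign. With \<open>s = (-1)\<^bsup>k\<^esup>\<close> and \<open>c = \<rho> k - s\<close>, the
  coefficient of \<open>h\<close> in the braid relation at \<open>e\<close> gives \<open>c (s - \<eta>\<^sub>k\<^sub>k) = 0\<close>. For \<open>k = 1\<close> the three vectors are
  dependent and the conclusion can fail.
\<close>

lemma deviation_from_flip: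
  assumes k: "2 \<le> k" "k \<le> n" and sgn: "\<And>j. j < k \<Longrightarrow> \<rho> j = (-1) ^ j"
  shows "\<rho> k = (-1) ^ k"
proof (rule ccontr)
  assume ne: "\<rho> k \<noteq> (-1) ^ k"
  define s :: complex where "s = (-1) ^ k"
  have ss: "s * s = 1" "s * (s * x) = x" for x using sign_square[of k] by (simp_all add: s_def mult.assoc[symmetric])
  let ?X = "\<lambda>W i j. \<Phi> W i j - W j i" and ?c = "\<rho> k - s"
  let ?e = "hw12 n k" and ?f = "hw23 n k" and ?h = "hw13 n k" and ?y = "eta n k"
  have X: "intertwiner n ?X" by (rule intertwiner_diff[OF inter intertwiner_flip])
  have z: "?X (hw n j) = (\<lambda>i j. 0)" if "j < k" for j
  proof -
    have "j \<le> n" using that k by simp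
    show ?thesis
      unfolding eigen[OF \<open>j \<le> n\<close>] sgn[OF that] hw_swap[of n j _ _, symmetric] by simp
  qed
  have g: "?X (hw n k) = (\<lambda>i j. ?c * hw n k i j)"
  proof (intro ext)
    fix i j show "?X (hw n k) i j = ?c * hw n k i j"
      unfolding eigen[OF k(2)] using hw_swap[of n k j i] by (simp add: s_def algebra_simps)
  qed
  have on12: "on12 \<Phi> T = (\<lambda>i j l. T j i l + ?c * hw_coeff n k (\<lambda>a b. T a b 0) * ?e i j l)"
    if "level3 n k T" for T
  proof (intro ext)
    fix i j l
    have "on12 ?X T i j l = ?c * hw_coeff n k (\<lambda>a b. T a b 0) * ?e i j l"
      using on12_at[OF X z k(2) g that] by simp
    then show "on12 \<Phi> T i j l = T j i l + ?c * hw_coeff n k (\<lambda>a b. T a b 0) * ?e i j l"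
      by (simp add: on12_def algebra_simps)
  qed
  note lev = level3_hw[OF k(2)] and co = hw_coeff_slices[OF k(2), folded s_def]
  have e12: "on12 \<Phi> ?e = (\<lambda>i j l. \<rho> k * ?e i j l)"
  proof (intro ext)
    fix i j l show "on12 \<Phi> ?e i j l = \<rho> k * ?e i j l"
      unfolding on12[OF lev(1)] co using hw_swap[of n k j i] by (simp add: hw12_def s_def algebra_simps)
  qed
  have f12: "on12 \<Phi> ?f = (\<lambda>i j l. 1 * ?h i j l + ?c * s * ?y * ?e i j l)"
    unfolding on12[OF lev(2)] co by (intro ext) (simp add: hw13_def hw23_def)
  have h12: "on12 \<Phi> ?h = (\<lambda>i j l. 1 * ?f i j l + ?c * ?y * ?e i j l)"
    unfolding on12[OF lev(3)] co by (intro ext) (simp add: hw13_def hw23_def)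
  note rev = rev3_hw[of n k, folded s_def]
  have rev': "?e l j i = s * ?f i j l" "?f l j i = s * ?e i j l" "?h l j i = s * ?h i j l" for i j l
    using fun_cong[OF fun_cong[OF fun_cong[OF rev(1), of i], of j], of l]
      fun_cong[OF fun_cong[OF fun_cong[OF rev(2), of i], of j], of l]
      fun_cong[OF fun_cong[OF fun_cong[OF rev(3), of i], of j], of l] by (simp_all add: rev3_def)
  have f23: "on23 \<Phi> ?f = (\<lambda>i j l. \<rho> k * ?f i j l)"
  proof (intro ext)
    fix i j l show "on23 \<Phi> ?f i j l = \<rho> k * ?f i j l"
      unfolding on23_rev3[OF lev(2)] rev on12_scale[OF inter] e12 unfolding rev3_def rev'[of l j i]
      using ss(2)[of "\<rho> k * ?f i j l"] by (simp only: mult.left_commute)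
  qed
  have e23: "on23 \<Phi> ?e = (\<lambda>i j l. 1 * ?h i j l + ?c * s * ?y * ?f i j l)"
  proof (intro ext)
    fix i j l
    have "on23 \<Phi> ?e i j l = s * (s * ?h i j l) + s * (s * (?c * s * ?y * ?f i j l))"
      unfolding on23_rev3[OF lev(1)] rev on12_scale[OF inter] f12 unfolding rev3_def rev'[of l j i]
      by (simp only: distrib_left mult_1 mult_ac)
    then show "on23 \<Phi> ?e i j l = 1 * ?h i j l + ?c * s * ?y * ?f i j l" unfolding ss by simp
  qed
  have h23: "on23 \<Phi> ?h = (\<lambda>i j l. 1 * ?e i j l + ?c * ?y * ?f i j l)"
  proof (intro ext)
    fix i j l
    have "on23 \<Phi> ?h i j l = s * (s * ?e i j l) + s * (s * (?c * ?y * ?f i j l))"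
      unfolding on23_rev3[OF lev(3)] rev on12_scale[OF inter] h12 unfolding rev3_def rev'[of l j i]
      by (simp only: distrib_left mult_1 mult_ac)
    then show "on23 \<Phi> ?h i j l = 1 * ?e i j l + ?c * ?y * ?f i j l" unfolding ss by simp
  qed
  (* At this index only h is nonzero, because k is at least 2. *)
  have at: "?e 1 0 (k - 1) = 0" "?f 1 0 (k - 1) = 0" and h0: "?h 1 0 (k - 1) \<noteq> 0"
    using k by (simp_all add: hw12_def hw23_def hw13_def hw_def)
  have "on12 \<Phi> (on23 \<Phi> (on12 \<Phi> ?e)) 1 0 (k - 1) = \<rho> k * (?c * s * ?y * ?h 1 0 (k - 1))"
    unfolding e12 on23_scale[OF inter] e23 on12_scale[OF inter] on12_linear[OF inter] f12 h12
    using at by simp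
  moreover have "on23 \<Phi> (on12 \<Phi> (on23 \<Phi> ?e)) 1 0 (k - 1) =
      (?c * ?y + ?c * s * ?y * (?c * s * ?y)) * ?h 1 0 (k - 1)"
    unfolding e23 on12_linear[OF inter] f12 h12 on23_linear[OF inter] e23 f23 h23
    using at by (simp add: algebra_simps)
  moreover have "1 \<le> n" "k - 1 \<le> n" using k by simp_all
  ultimately have "(\<rho> k * (?c * s * ?y)) * ?h 1 0 (k - 1) =
      (?c * ?y + ?c * s * ?y * (?c * s * ?y)) * ?h 1 0 (k - 1)"
    using braid[of 1 0 "k - 1" ?e] by (simp only: mult.assoc le0)
  then have "\<rho> k * (?c * s * ?y) = ?c * ?y + ?c * s * ?y * (?c * s * ?y)"
    by (rule mult_right_cancel[OF h0, THEN iffD1])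
  then have "(?c * ?y) * (\<rho> k * s) = ?c * ?y + (s * s) * ((?c * ?y) * (?c * ?y))"
    by (simp only: mult_ac)
  then have "(?c * ?y) * (\<rho> k * s) = (?c * ?y) * (1 + ?c * ?y)"
    by (simp only: ss(1) distrib_left mult_1 mult_1_right)
  moreover have c0: "?c \<noteq> 0" using ne by (simp add: s_def)
  ultimately have 1: "\<rho> k * s = 1 + ?c * ?y" using eta_nonzero by simp
  have "?c * (s - ?y) = 0" using 1 ss(1) by (simp add: algebra_simps)
  then have "s = ?y" using c0 by simp
  moreover have "norm s = 1" by (simp add: s_def norm_power)
  ultimately show False using norm_eta_less_one[of k n] k by simp
qed

end

section \<open>Classification\<close>

lemma intertwiner_eqI:
  assumes "intertwiner n \<Phi>" "intertwiner n \<Psi>" and "\<And>k. k \<le> n \<Longrightarrow> \<Phi> (hw n k) = \<Psi> (hw n k)" and "level n l W"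
  shows "\<Phi> W = \<Psi> W"
proof -
  have "(\<lambda>i j. \<Phi> W i j - \<Psi> W i j) = (\<lambda>i j. 0)"
    by (rule intertwiner_eq_zero[OF intertwiner_diff[OF assms(1,2)] _ assms(4)]) (simp add: assms(3))
  then have "\<Phi> W i j - \<Psi> W i j = 0" for i j by (rule fun_cong[OF fun_cong])
  then show ?thesis by (intro ext) simp
qed

lemma eta_one:
  assumes "1 \<le> n"
  shows "eta n 1 = 1 / 2"
proof -
  obtain p where n: "n = Suc p" using assms by (cases n) auto
  have "fact (2 * n - 1 + 1) = (of_nat (2 * n) * fact (2 * n - 2 * 1 + 1) :: complex)"
    by (simp add: n algebra_simps)
  moreover have "fact n = (of_nat n * fact (n - 1) :: complex)" by (simp add: n)
  moreover have "of_nat n \<noteq> (0 :: complex)" using assms by simp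
  ultimately show ?thesis unfolding eta_def by (simp del: fact_Suc)
qed

theorem proposition1:
  fixes n :: nat and r :: "nat \<Rightarrow> complex" and P :: "nat \<Rightarrow> complex mat" and R :: "complex mat"
  assumes n: "n \<ge> 2"
    and P: "\<And>j. j \<le> n \<Longrightarrow> spin_projector n j (P j)"
    and R: "R = lincomb_mat n {0..n} r P"
    and YB: "op12 n R * op23 n R * op12 n R = op23 n R * op12 n R * op23 n R"
    and top: "r n = 1"
  shows "(r (n - 1) = 1 \<or> r (n - 1) = -1) \<and>
    (r (n - 1) = 1 \<and> R \<noteq> 1\<^sub>m ((n+1)^2) \<longrightarrow>
      (\<exists>m g r'. 2 \<le> m \<and> m \<le> n \<and>
        R = 1\<^sub>m ((n+1)^2) + g \<cdot>\<^sub>m P (n - m) + lincomb_mat n {..<n - m} r' P \<and>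
        1 + g + (eta n m)^2 * g^2 = 0 \<and>
        (m < n \<longrightarrow> r' (n - m - 1) \<noteq> 0))) \<and>
    (r (n - 1) = -1 \<longrightarrow> R = flip_mat n)"
proof -
  let ?N = "(n+1)^2" and ?\<rho> = "\<lambda>k. r (n - k)"
  have Rc: "R \<in> carrier_mat ?N ?N" unfolding R by (rule lincomb_carrier)
  have Pc: "P j \<in> carrier_mat ?N ?N" if "j \<le> n" for j using P[OF that] by (rule projector_carrier)
  have inter: "intertwiner n (act n R)"
    unfolding R by (rule lincomb_projectors(1)[OF P]) auto
  have eigen: "act n R (hw n k) = (\<lambda>i j. ?\<rho> k * hw n k i j)" if "k \<le> n" for k
    unfolding R using lincomb_projectors(2)[OF P _ that, of "{0..n}" r] by simp
  interpret sl2_braiding n "act n R" ?\<rho>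
    by unfold_locales (fact inter, fact eigen, rule braid_relation_coords[OF Rc YB])
  have dichotomy: "r (n - 1) = 1 \<or> r (n - 1) = -1"
  proof (rule disjCI)
    assume "r (n - 1) \<noteq> -1"
    show "r (n - 1) = 1"
    proof (rule ccontr)
      assume ne: "r (n - 1) \<noteq> 1"
      have half: "eta n 1 = 1 / 2" by (rule eta_one) (use n in simp)
      have "1 + (r (n - 1) - 1) + (eta n 1)\<^sup>2 * (r (n - 1) - 1)\<^sup>2 = 0"
        by (rule first_deviation) (use n top ne in auto)
      then have "1 + (r (n - 1) - 1) + (1 / 2)\<^sup>2 * (r (n - 1) - 1)\<^sup>2 = 0" unfolding half .
      moreover have "(r (n - 1) + 1)\<^sup>2 = 4 * (1 + (r (n - 1) - 1) + (1 / 2)\<^sup>2 * (r (n - 1) - 1)\<^sup>2)"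
        by (simp add: power2_eq_square field_simps)
      ultimately have "(r (n - 1) + 1)\<^sup>2 = 0" by (simp only: mult_zero_right)
      then show False using \<open>r (n - 1) \<noteq> -1\<close> by (simp add: eq_neg_iff_add_eq_0)
    qed
  qed
  have flip: "R = flip_mat n" if "r (n - 1) = -1"
  proof -
    have sgn: "?\<rho> k = (-1) ^ k" if "k \<le> n" for k
      using that
    proof (induction k rule: less_induct)
      case (less k)
      consider "k = 0" | "k = 1" | "2 \<le> k" by linarith
      then show ?case
      proof cases
        case 3
        then show ?thesis using deviation_from_flip[of k] less by simp
      qed (use top \<open>r (n - 1) = -1\<close> in simp_all)
    qed
    show ?thesis
    proof (rule mat_eq_by_levels[OF Rc])
      show "flip_mat n \<in> carrier_mat ?N ?N" by (simp add: flip_mat_def)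
      fix l W assume W: "level n l W"
      have "act n R W = (\<lambda>i j. W j i)"
        by (rule intertwiner_eqI[OF inter intertwiner_flip _ W]) (simp only: eigen sgn hw_flip)
      then show "act n R W = act n (flip_mat n) W" by (simp only: act_flip_mat[OF W])
    qed
  qed
  have expansion: "\<exists>m g r'. 2 \<le> m \<and> m \<le> n \<and>
        R = 1\<^sub>m ?N + g \<cdot>\<^sub>m P (n - m) + lincomb_mat n {..<n - m} r' P \<and>
        1 + g + (eta n m)^2 * g^2 = 0 \<and> (m < n \<longrightarrow> r' (n - m - 1) \<noteq> 0)"
    if r1: "r (n - 1) = 1" and ne: "R \<noteq> 1\<^sub>m ?N"
  proof -
    have "\<exists>k\<le>n. ?\<rho> k \<noteq> 1"
    proof (rule ccontr)
      assume all: "\<not> (\<exists>k\<le>n. ?\<rho> k \<noteq> 1)"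
      have "R = 1\<^sub>m ?N"
      proof (rule mat_eq_by_levels[OF Rc one_carrier_mat])
        fix l W assume W: "level n l W"
        have "act n R W = W"
          by (rule intertwiner_eqI[OF inter intertwiner_id _ W]) (use all eigen in auto)
        then show "act n R W = act n (1\<^sub>m ?N) W" by (simp only: act_one[OF W])
      qed
      then show False using ne by simp
    qed
    then obtain m0 where "m0 \<le> n \<and> ?\<rho> m0 \<noteq> 1" by blast
    define m where "m = (LEAST k. k \<le> n \<and> ?\<rho> k \<noteq> 1)"
    have m: "m \<le> n" "?\<rho> m \<noteq> 1"
      using LeastI[of "\<lambda>k. k \<le> n \<and> ?\<rho> k \<noteq> 1", OF \<open>m0 \<le> n \<and> _\<close>] by (simp_all add: m_def)
    have one: "?\<rho> k = 1" if "k < m" for k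
      using not_less_Least[of k "\<lambda>k. k \<le> n \<and> ?\<rho> k \<noteq> 1"] that m(1) by (simp add: m_def)
    have m2: "2 \<le> m"
    proof (rule ccontr)
      assume "\<not> 2 \<le> m"
      then have "m = 0 \<or> m = 1" by linarith
      then show False using m(2) top r1 by auto
    qed
    define g where "g = ?\<rho> m - 1"
    define r' where "r' j = r j - 1" for j
    let ?L = "lincomb_mat n {..<n - m} r' P"
    have J: "{..<n - m} \<subseteq> {..n}" by auto
    have L: "intertwiner n (act n ?L)"
      "\<And>k. k \<le> n \<Longrightarrow> act n ?L (hw n k) = (\<lambda>i j. (if n - k < n - m then r' (n - k) else 0) * hw n k i j)"
      using lincomb_projectors[OF P J, where r = r'] by simp_all
    have nm: "n - m \<le> n" by simp
    have c: "1\<^sub>m ?N + g \<cdot>\<^sub>m P (n - m) \<in> carrier_mat ?N ?N" "g \<cdot>\<^sub>m P (n - m) \<in> carrier_mat ?N ?N"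
      using Pc[OF nm] by simp_all
    (* The factors 1 give the shape of intertwiner_combination. *)
    let ?\<Psi> = "\<lambda>W i j. 1 * (1 * W i j + g * act n (P (n - m)) W i j) + 1 * act n ?L W i j"
    have \<Psi>: "intertwiner n ?\<Psi>"
      by (intro intertwiner_combination intertwiner_id intertwiner_projector[OF P[OF nm]] L)
    have "R = 1\<^sub>m ?N + g \<cdot>\<^sub>m P (n - m) + ?L"
    proof (rule mat_eq_by_levels[OF Rc])
      show "1\<^sub>m ?N + g \<cdot>\<^sub>m P (n - m) + ?L \<in> carrier_mat ?N ?N" using lincomb_carrier by (rule add_carrier_mat)
      fix l W assume W: "level n l W"
      have "act n R W = ?\<Psi> W"
      proof (rule intertwiner_eqI[OF inter \<Psi> _ W])
        fix k assume k: "k \<le> n"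
        show "act n R (hw n k) = ?\<Psi> (hw n k)"
        proof (intro ext)
          fix i j
          have nk: "k = n - (n - m) \<longleftrightarrow> k = m" "n - k < n - m \<longleftrightarrow> m < k" using m(1) k by auto
          consider "k < m" | "k = m" | "m < k" by linarith
          then show "act n R (hw n k) i j = ?\<Psi> (hw n k) i j"
            unfolding eigen[OF k] projector_hw[OF P[OF nm] nm k] L(2)[OF k] nk
            by cases (simp_all add: one g_def r'_def algebra_simps)
        qed
      qed
      also have "\<dots> = act n (1\<^sub>m ?N + g \<cdot>\<^sub>m P (n - m) + ?L) W"
        unfolding act_add[OF c(1) lincomb_carrier] act_add[OF one_carrier_mat c(2)] act_smult[OF Pc[OF nm]] act_one[OF W]
        by simp
      finally show "act n R W = act n (1\<^sub>m ?N + g \<cdot>\<^sub>m P (n - m) + ?L) W" .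
    qed
    moreover have "1 + g + (eta n m)^2 * g^2 = 0"
      unfolding g_def by (rule first_deviation) (use m m2 one in auto)
    moreover have "r' (n - m - 1) \<noteq> 0" if "m < n"
      using second_deviation[OF m2 that one m(2)] by (simp add: r'_def)
    ultimately show ?thesis using m2 m(1) by blast
  qed
  show ?thesis using dichotomy expansion flip by blast
qed

end
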